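(* Let $k$ be a field with $\operatorname{char} k\neq 2$, and let $C/k$ be the hyperelliptic curve $$C:\ Y^2=c f(X),\qquad f(X)=\prod_{r\in R}(X-r),$$ where $R\subset\bar k$ is a finite non-empty set and $cf(X)\in k[X]$. Let $G\subset\operatorname{Aut}_kC$ be a finite group of automorphisms acting via $g(X)=\alpha(g)X+\beta(g)$, $g(Y)=\gamma(g)Y$ ($g\in G$), with $\alpha(g),\beta(g),\gamma(g)\in k$. Let $I=\prod_{g\in G}g(X)$, and write $R/G$ for the set of orbits of $G$ on the roots of $f$ through the $X$-coordinate action. 1. If $G$ contains the hyperelliptic involution, then $C/G\simeq\mathbb P^1_k$, with field of rational functions $k(C/G)=k(\sqrt I)$. 2. If $G$ acts trivially on the $Y$-coordinate, then $$C/G:\ y^2=c\,(-1)^{|R|-|R/G|}\prod_{O\in R/G}\Bigl(x-\prod_{r\in O}r\Bigr)$$ with $x=I$ and $y=Y$. 3. Otherwise, $$C/G:\ y^2=c\,(-1)^{\delta}(x-\lambda^m)\prod_{O\in R/G,\ O\neq U}\Bigl(x-\prod_{r\in O}r\Bigr)$$ with $x=I$ and $y=(I_T-\lambda)^{\lfloor m/2\rfloor}Y$. Here $U$ is the set of $a\in k$ that are fixed points of some non-trivial $g\in G$ acting through the $X$-coordinate, and $$m=\frac{|G|}{|U|},\quad \lambda=\prod_{a\in U}a,\quad \delta=(m-1)(|R/G|-1),\quad I_T=\prod_{g\in\ker\alpha}g(X).$$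
   Context: $C$ is the smooth projective curve with the given affine equation; genus $\le 1$ is allowed. The hyperelliptic involution is $(X,Y)\mapsto(X,-Y)$. $g(X)$ denotes the polynomial $\alpha(g)X+\beta(g)$, and $G$ acts on $\bar k$ through the $X$-coordinate by $a\mapsto\alpha(g)a+\beta(g)$; this preserves $R$. The function field of $C/G$ is $k(C)^G\subset k(C)=k(X,Y)$; the statements "with $x=\dots$, $y=\dots$" say that these functions generate $k(C)^G$ and satisfy the given equation. In (1), $I$ is a square in $k(X)$ and $\sqrt I$ denotes a square root in $k(X)$. *)

theory Defs
  imports "HOL-Algebra.Algebraic_Closure_Type" "HOL-Algebra.Finite_Extensions"
    "HOL-Algebra.Generated_Fields"
begin

text \<open>
  A smooth projective curve over \<open>k\<close> is represented by its function field: a field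
  \<open>'K\<close> with an embedding \<open>\<iota>\<close> of the constant field \<open>'k\<close>.
  The quotient of a curve by a finite group of automorphisms is represented by the fixed field.
  A type class field is regarded as a HOL-Algebra ring through \<^const>\<open>ring_of_type_algebra\<close>.
\<close>

definition field_embedding :: "('k::field \<Rightarrow> 'K::field) \<Rightarrow> bool" where
  "field_embedding \<iota> \<longleftrightarrow> \<iota> \<in> ring_hom ring_of_type_algebra ring_of_type_algebra"

definition adjoin :: "('k::field \<Rightarrow> 'K::field) \<Rightarrow> 'K set \<Rightarrow> 'K set" where
  "adjoin \<iota> S = generate_field ring_of_type_algebra (range \<iota> \<union> S)"

text \<open>
  \<open>F\<close> is the function field \<open>k(x, y)\<close> of the curve \<open>y\<^sup>2 = H(x)\<close>. The polynomial \<open>H\<close>, given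
  with coefficients in the algebraic closure (so that it can be written as a product over its
  roots), is required to have coefficients in \<open>k\<close>. Besides generation and the equation, the
  definition says that \<open>x\<close> is a genuine coordinate and that \<open>y\<close> has degree 2 over \<open>k(x)\<close>,
  i.e. that \<open>x, y\<close> satisfy no relations but the consequences of the equation.
\<close>
definition function_field_of_equation ::
    "('k::field \<Rightarrow> 'K::field) \<Rightarrow> 'K set \<Rightarrow> 'k alg_closure poly \<Rightarrow> 'K \<Rightarrow> 'K \<Rightarrow> bool" where
  "function_field_of_equation \<iota> F H x y \<longleftrightarrow>
     F = adjoin \<iota> {x, y} \<and>
     ring.transcendental ring_of_type_algebra (range \<iota>) x \<and>
     y \<notin> adjoin \<iota> {x} \<and>
     (\<exists>h :: 'k poly. map_poly to_ac h = H \<and> y ^ 2 = poly (map_poly \<iota> h) x)"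

text \<open>
  The curve with function field \<open>F\<close> is isomorphic over \<open>k\<close> to the projective line: \<open>F\<close> is
  isomorphic over \<open>k\<close> to the field \<open>k(t)\<close> of rational functions.
\<close>
definition is_projective_line :: "('k::field \<Rightarrow> 'K::field) \<Rightarrow> 'K set \<Rightarrow> bool" where
  "is_projective_line \<iota> F \<longleftrightarrow>
     (\<exists>\<phi> :: 'k poly fract \<Rightarrow> 'K. field_embedding \<phi> \<and> range \<phi> = F \<and>
        (\<forall>a. \<phi> (Fraction_Field.Fract [:a:] 1) = \<iota> a))"

text \<open>
  The \<open>k\<close>-automorphisms of the function field, acting on functions by pull-back. As an abstract
  group this is opposite to the automorphism group of the curve; subgroups and orbits are the same.
\<close>
definition aut_group :: "('k::field \<Rightarrow> 'K::field) \<Rightarrow> ('K \<Rightarrow> 'K) monoid" where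
  "aut_group \<iota> =
     \<lparr>carrier = {g \<in> ring_iso ring_of_type_algebra ring_of_type_algebra. \<forall>a. g (\<iota> a) = \<iota> a},
      monoid.mult = (\<circ>), one = id\<rparr>"

definition fixed_field :: "('K \<Rightarrow> 'K) set \<Rightarrow> 'K set" where
  "fixed_field G = {z. \<forall>g\<in>G. g z = z}"

text \<open>
  The orbits on \<open>R\<close> of the action \<open>a \<mapsto> \<alpha>(g) a + \<beta>(g)\<close> on the algebraic closure.
\<close>
definition root_orbits ::
    "('g \<Rightarrow> 'k::field) \<Rightarrow> ('g \<Rightarrow> 'k) \<Rightarrow> 'g set \<Rightarrow> 'k alg_closure set \<Rightarrow> 'k alg_closure set set" where
  "root_orbits \<alpha> \<beta> G R = (\<lambda>r. (\<lambda>g. to_ac (\<alpha> g) * r + to_ac (\<beta> g)) ` G) ` R"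

end

theory Submission
  imports Defs
begin

text \<open>
  A finite group \<open>P\<close> of affine maps \<open>x \<mapsto> ax + b\<close> has invariant polynomial ring \<open>k[N]\<close> with
  \<open>N = \<Prod>\<^sub>p p(X)\<close>: division by \<open>N\<close> preserves invariance, and an invariant polynomial of degree
  less than \<open>|P|\<close> is constant. Taking norms of denominators, \<open>k(X)\<^sup>P = k(N)\<close>. The same argument
  gives \<open>N - N(x) = A \<Prod>\<^sub>p (X - p(x))\<close>, where the leading coefficient \<open>A\<close> is \<open>(-1)\<close> to the power \<open>|P| + 1\<close>.
  So the factor of \<open>f\<close> belonging to an orbit of size \<open>|P|\<close> is \<open>N\<close> minus a constant, up to \<open>A\<close>.
  The points with non-trivial stabilizer form one orbit \<open>W\<close> of the translation subgroup, and
  \<open>N - \<lambda>\<^sup>m\<close> is \<open>A\<close> times the \<open>m\<close>-th power of the polynomial with roots \<open>W\<close>.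

  Every function on the curve is \<open>a + bY\<close> with \<open>a, b \<in> k(X)\<close>, so it only remains to find a
  multiple of \<open>Y\<close> that is invariant. Here \<open>\<gamma>(g)\<^sup>2 = \<alpha>(g)\<close> if \<open>W \<subseteq> R\<close>, and \<open>\<gamma>(g)\<^sup>2 = 1\<close> otherwise;
  \<open>m\<close> is odd in the first case and even in the second, and both times
  \<open>\<alpha>(g)\<close> to the power \<open>\<lfloor>m/2\<rfloor>\<close> is \<open>\<gamma>(g)\<^sup>-\<^sup>1\<close>.
\<close>

section \<open>Finite groups of affine maps\<close>

lemma prod_const_fibres:
  fixes F :: "'b \<Rightarrow> 'c::comm_semiring_1"
  assumes "finite S" "\<And>y. y \<in> h ` S \<Longrightarrow> card {x \<in> S. h x = y} = n"
  shows "(\<Prod>x\<in>S. F (h x)) = (\<Prod>y\<in>h ` S. F y) ^ n"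
proof -
  have "(\<Prod>x\<in>S. F (h x)) = (\<Prod>y\<in>h ` S. \<Prod>x\<in>{x \<in> S. h x = y}. F (h x))"
    by (rule prod.image_gen) (rule assms)
  also have "\<dots> = (\<Prod>y\<in>h ` S. F y ^ n)"
    by (intro prod.cong refl) (simp add: assms)
  finally show ?thesis by (simp only: prod_power_distrib)
qed

lemma card_const_fibres:
  assumes "finite S" "\<And>y. y \<in> h ` S \<Longrightarrow> card {x \<in> S. h x = y} = n"
  shows "card S = card (h ` S) * n"
proof -
  have "card S = (\<Sum>x\<in>S. 1)" by simp
  also have "\<dots> = (\<Sum>y\<in>h ` S. \<Sum>x\<in>{x \<in> S. h x = y}. 1)"
    by (rule sum.image_gen) (rule assms)
  also have "\<dots> = card (h ` S) * n" by (simp add: assms)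
  finally show ?thesis .
qed

lemma even_card_involution:
  assumes "finite S" "\<And>x. x \<in> S \<Longrightarrow> h x \<in> S \<and> h x \<noteq> x \<and> h (h x) = x"
  shows "even (card S)"
  using assms
proof (induction S rule: finite_psubset_induct)
  case (psubset S)
  show ?case
  proof (cases "S = {}")
    case False
    then obtain x where x: "x \<in> S" by blast
    have "even (card (S - {x, h x}))"
    proof (rule psubset.IH)
      fix y assume y: "y \<in> S - {x, h x}"
      then have hy: "h y \<in> S" "h y \<noteq> y" "h (h y) = y" using psubset.prems by auto
      have "h y \<noteq> x" "h y \<noteq> h x"
        using y hy(3) psubset.prems[OF x] by auto
      then show "h y \<in> S - {x, h x} \<and> h y \<noteq> y \<and> h (h y) = y" using hy by simp
    qed (use x in auto)
    moreover have "card (S - {x, h x}) = card S - 2"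
      using psubset.prems[OF x] x psubset.hyps by (subst card_Diff_subset) auto
    moreover have "card S \<ge> 2"
      using psubset.prems[OF x] x psubset.hyps card_mono[of S "{x, h x}"] by auto
    ultimately show ?thesis by simp
  qed simp
qed

text \<open>Both sides are monic of degree \<open>card Z\<close> and agree on \<open>Z\<close>, so
  their difference, of smaller degree, has too many roots.\<close>

lemma prod_linear_eqI:
  fixes p :: "'a::field poly"
  assumes "finite Z" "lead_coeff p = 1" "degree p = card Z" "\<And>z. z \<in> Z \<Longrightarrow> poly p z = 0"
  shows "p = (\<Prod>z\<in>Z. [:- z, 1:])"
proof (rule poly_eqI_degree_lead_coeff[where A = Z and n = "card Z"])
  show "degree (\<Prod>z\<in>Z. [:- z, 1:]) \<le> card Z"
    by (subst degree_prod_eq_sum_degree) auto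
  have "degree (\<Prod>z\<in>Z. [:- z, 1:]) = card Z"
    by (subst degree_prod_eq_sum_degree) auto
  then show "coeff p (card Z) = coeff (\<Prod>z\<in>Z. [:- z, 1:]) (card Z)"
    using assms lead_coeff_prod[of "\<lambda>z. [:- z, 1:]" Z] by simp
  show "poly p z = poly (\<Prod>z\<in>Z. [:- z, 1:]) z" if "z \<in> Z" for z
    using that assms by (auto simp: poly_prod)
qed (use assms in auto)

section \<open>Finite subgroups of the multiplicative group of a field\<close>

locale finite_units =
  fixes M :: "'a::field set"
  assumes finite_M: "finite M" and one_M: "1 \<in> M" and zero_M: "0 \<notin> M"
    and mult_M: "x \<in> M \<Longrightarrow> y \<in> M \<Longrightarrow> x * y \<in> M"
begin

text \<open>Lagrange's theorem in the abelian case: multiplication by \<open>x\<close> permutes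
  \<open>M\<close>, so the product of all elements equals \<open>x ^ card M\<close> times
  itself.\<close>

lemma power_card:
  assumes "x \<in> M" shows "x ^ card M = 1"
proof -
  have "inj_on ((*) x) M" using assms zero_M by (auto simp: inj_on_def)
  moreover from this have "(*) x ` M = M"
    by (intro endo_inj_surj finite_M) (use assms mult_M in auto)
  ultimately have "(\<Prod>y\<in>M. y) = (\<Prod>y\<in>M. x * y)"
    using prod.reindex[of "(*) x" M "\<lambda>y. y"] by simp
  also have "\<dots> = x ^ card M * (\<Prod>y\<in>M. y)" by (simp add: prod.distrib)
  finally show ?thesis using zero_M finite_M by auto
qed

text \<open>By \<open>power_card\<close>, \<open>M\<close> is the full set of roots of T^n - 1 with
  n = \<open>card M\<close>, and the product is read off from the constant term.\<close>

lemma prod_eq: "(\<Prod>x\<in>M. x) = (- 1) ^ (card M + 1)"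
proof -
  have pos: "card M > 0" using finite_M one_M by (auto simp: card_gt_0_iff)
  define p :: "'a poly" where "p = Polynomial.monom 1 (card M) - 1"
  have c: "coeff p (card M) = 1" using pos by (simp add: p_def)
  have "degree p \<le> card M" by (auto simp: p_def intro!: degree_diff_le degree_monom_le)
  then have d: "degree p = card M" using c by (intro antisym le_degree) auto
  have "p = (\<Prod>z\<in>M. [:- z, 1:])"
    by (rule prod_linear_eqI)
      (use finite_M c d power_card in \<open>auto simp: p_def poly_monom\<close>)
  then have "poly p 0 = (\<Prod>z\<in>M. - z)" by (simp add: poly_prod)
  then have "(- 1) ^ card M * (\<Prod>z\<in>M. z) = - 1"
    using pos by (simp add: p_def poly_monom zero_power prod_uminus)
  then have "(- 1) ^ card M * ((- 1) ^ card M * (\<Prod>z\<in>M. z)) = (- 1) ^ card M * - 1" by simp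
  then show ?thesis by (simp flip: mult.assoc power_add)
qed

lemma card_roots_power_le:
  assumes "S \<subseteq> M" "k > 0" "\<And>x. x \<in> S \<Longrightarrow> x ^ k = 1"
  shows "card S \<le> k"
proof -
  define p :: "'a poly" where "p = Polynomial.monom 1 k - 1"
  have c: "coeff p k = 1" using assms by (simp add: p_def)
  have "p \<noteq> 0" using c by auto
  moreover have "S \<subseteq> {x. poly p x = 0}" using assms by (auto simp: p_def poly_monom)
  ultimately have "card S \<le> card {x. poly p x = 0}" by (intro card_mono poly_roots_finite)
  also have "\<dots> \<le> degree p" using c by (intro card_poly_roots_bound) auto
  also have "\<dots> \<le> k" by (auto simp: p_def intro!: degree_diff_le degree_monom_le)
  finally show ?thesis .
qed

text \<open>If \<open>card M\<close> = 2k, some \<open>x\<close> is not a root of T^k - 1, and then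
  \<open>x ^ k\<close> is a square root of 1 other than 1.\<close>

lemma minus_one_mem:
  assumes "even (card M)" shows "- 1 \<in> M"
proof -
  obtain k where k: "card M = 2 * k" using assms by blast
  have pos: "card M > 0" using finite_M one_M by (auto simp: card_gt_0_iff)
  have pow_M: "x ^ j \<in> M" if "x \<in> M" for x j
    using that by (induction j) (auto simp: one_M mult_M)
  have "\<not> (\<forall>x\<in>M. x ^ k = 1)"
    using card_roots_power_le[of M k] pos k by auto
  then obtain x where x: "x \<in> M" "x ^ k \<noteq> 1" by blast
  have "(x ^ k) ^ 2 = 1" using power_card[OF x(1)] k by (simp add: mult.commute power_mult)
  then have "x ^ k = - 1" using x by (simp add: power2_eq_1_iff)
  then show ?thesis using pow_M[OF x(1), of k] by simp
qed

end

section \<open>Affine maps x -> ax + b, encoded as pairs (a, b), and their finite groups\<close>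

definition aff_mult :: "'a::field \<times> 'a \<Rightarrow> 'a \<times> 'a \<Rightarrow> 'a \<times> 'a" where
  "aff_mult p q = (fst p * fst q, fst p * snd q + snd p)"

definition aff_act :: "'a::field \<times> 'a \<Rightarrow> 'a \<Rightarrow> 'a" where
  "aff_act p x = fst p * x + snd p"

definition aff_poly :: "'a::field \<times> 'a \<Rightarrow> 'a poly" where
  "aff_poly p = [:snd p, fst p:]"

lemma aff_act_mult: "aff_act (aff_mult p q) x = aff_act p (aff_act q x)"
  by (simp add: aff_act_def aff_mult_def algebra_simps)

lemma poly_aff_poly [simp]: "poly (aff_poly p) x = aff_act p x"
  by (simp add: aff_poly_def aff_act_def algebra_simps)

lemma pcompose_aff_poly: "pcompose (aff_poly p) (aff_poly q) = aff_poly (aff_mult p q)"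
  by (simp add: aff_poly_def aff_mult_def pcompose_pCons algebra_simps)

lemma inj_aff_poly: "inj aff_poly"
  by (auto simp: inj_def aff_poly_def)

text \<open>Inverses come from finiteness, see \<open>inverse_ex\<close>.\<close>

locale affine_group =
  fixes P :: "('a::field \<times> 'a) set"
  assumes finite_P: "finite P" and one_P: "(1, 0) \<in> P"
    and fst_nz: "p \<in> P \<Longrightarrow> fst p \<noteq> 0"
    and mult_P: "p \<in> P \<Longrightarrow> q \<in> P \<Longrightarrow> aff_mult p q \<in> P"
begin

abbreviation "invariant r \<equiv> (\<forall>p\<in>P. pcompose r (aff_poly p) = r)"

definition norm_poly :: "'a poly" where
  "norm_poly = (\<Prod>p\<in>P. aff_poly p)"

text \<open>The leading coefficient of \<open>norm_poly\<close>; \<open>lead_eq\<close> evaluates it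
  to a sign.\<close>

definition lead :: 'a where
  "lead = (\<Prod>p\<in>P. fst p)"

definition orb :: "'a \<Rightarrow> 'a set" where
  "orb x = (\<lambda>p. aff_act p x) ` P"

definition W :: "'a set" where
  "W = {x. \<exists>p\<in>P. p \<noteq> (1, 0) \<and> aff_act p x = x}"

text \<open>The translation subgroup, given by its shifts.\<close>

definition B :: "'a set" where
  "B = {b. (1, b) \<in> P}"

lemma card_P_pos: "card P > 0"
  using finite_P one_P by (auto simp: card_gt_0_iff)

lemma inj_left: "p \<in> P \<Longrightarrow> inj_on (aff_mult p) S"
  using fst_nz[of p] by (auto simp: inj_on_def aff_mult_def prod_eq_iff)

lemma inj_right: "p \<in> P \<Longrightarrow> inj_on (\<lambda>q. aff_mult q p) S"
  using fst_nz[of p] by (auto simp: inj_on_def aff_mult_def prod_eq_iff)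

lemma image_left: "p \<in> P \<Longrightarrow> aff_mult p ` P = P"
  by (intro endo_inj_surj finite_P inj_left) (auto simp: mult_P)

lemma image_right: "p \<in> P \<Longrightarrow> (\<lambda>q. aff_mult q p) ` P = P"
  by (intro endo_inj_surj finite_P inj_right) (auto simp: mult_P)

lemma prod_left: "p \<in> P \<Longrightarrow> prod F P = (\<Prod>q\<in>P. F (aff_mult p q))"
  using prod.reindex[OF inj_left, of p F P] image_left[of p] by simp

lemma prod_right: "p \<in> P \<Longrightarrow> prod F P = (\<Prod>q\<in>P. F (aff_mult q p))"
  using prod.reindex[OF inj_right, of p F P] image_right[of p] by simp

text \<open>Left multiplication by \<open>p\<close> is injective on a finite set, hence reaches the
  identity; that the right inverse is two-sided is a computation with coefficients.\<close>

lemma inverse_ex: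
  assumes "p \<in> P"
  obtains q where "q \<in> P" "aff_mult p q = (1, 0)" "aff_mult q p = (1, 0)"
proof -
  have "(1, 0) \<in> aff_mult p ` P" using image_left[OF assms] one_P by simp
  then obtain q where "q \<in> P" and q: "aff_mult p q = (1, 0)" by (auto simp: image_iff eq_commute)
  moreover have "aff_mult q p = (1, 0)"
  proof -
    have 1: "fst p * fst q = 1" and "fst p * snd q + snd p = 0"
      using q by (auto simp: aff_mult_def)
    then have "snd p = - (fst p * snd q)" by (simp add: add_eq_0_iff2)
    then have "fst q * snd p + snd q = snd q - (fst p * fst q) * snd q" by (simp add: algebra_simps)
    then show ?thesis using 1 by (simp add: aff_mult_def mult.commute)
  qed
  ultimately show ?thesis using that by blast
qed

section \<open>Invariant polynomials\<close>

lemma invariant_norm_poly: "invariant norm_poly"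
  unfolding norm_poly_def using prod_right[of _ aff_poly, symmetric]
  by (simp add: pcompose_prod pcompose_aff_poly)

lemma degree_norm_poly: "degree norm_poly = card P"
  unfolding norm_poly_def
  by (subst degree_prod_eq_sum_degree) (use fst_nz in \<open>auto simp: aff_poly_def\<close>)

lemma lead_coeff_norm_poly: "lead_coeff norm_poly = lead"
  unfolding norm_poly_def lead_def lead_coeff_prod
  by (intro prod.cong refl) (auto simp: aff_poly_def dest: fst_nz)

lemma norm_poly_nz: "norm_poly \<noteq> 0"
  using degree_norm_poly card_P_pos by auto

lemma invariant_small_degree:
  assumes "invariant r" "degree r < card P"
  shows "degree r = 0"
proof (rule ccontr)
  assume d: "degree r \<noteq> 0"
  \<comment> \<open>Over the ring of polynomials, \<open>r(Z) - r(X)\<close> has the \<open>card P\<close> distinct roots \<open>aX + b\<close>.\<close>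
  define s where "s = map_poly (\<lambda>c. [:c:]) r - [:r:]"
  have dr: "degree (map_poly (\<lambda>c. [:c:]) r) = degree r" by (rule degree_map_poly) simp
  then have ds: "degree s = degree r" unfolding s_def using d
    by (metis degree_add_eq_left degree_pCons_0 diff_conv_add_uminus gr0I minus_pCons minus_zero)
  have "s \<noteq> 0" using ds d by auto
  have "aff_poly ` P \<subseteq> {z. poly s z = 0}"
    using assms(1) by (auto simp: s_def pcompose_altdef)
  then have "card (aff_poly ` P) \<le> card {z. poly s z = 0}"
    by (intro card_mono poly_roots_finite \<open>s \<noteq> 0\<close>)
  also have "\<dots> \<le> degree s" by (rule card_poly_roots_bound) fact
  finally show False
    using assms(2) ds by (simp add: card_image inj_on_subset[OF inj_aff_poly])
qed

text \<open>Induction on the degree: the quotient by \<open>norm_poly\<close> is again invariant,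
  and the remainder is a constant, which becomes the constant coefficient of
  \<open>h\<close>.\<close>

lemma invariant_imp_pcompose_norm:
  assumes "invariant r"
  shows "\<exists>h. r = pcompose h norm_poly"
  using assms
proof (induction "degree r" arbitrary: r rule: less_induct)
  case less
  show ?case
  proof (cases "degree r = 0")
    case True
    then obtain a where "r = [:a:]" by (rule degree_eq_zeroE)
    then show ?thesis by (intro exI[of _ "[:a:]"]) simp
  next
    case False
    define s t where "s = r div norm_poly" and "t = r mod norm_poly"
    have r: "r = s * norm_poly + t" by (simp add: s_def t_def)
    have t: "t = 0 \<or> degree t < card P"
      using degree_mod_less[OF norm_poly_nz, of r] by (auto simp: t_def degree_norm_poly)
    have st: "pcompose s (aff_poly p) = s \<and> pcompose t (aff_poly p) = t" if p: "p \<in> P" for p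
    proof -
      let ?s = "pcompose s (aff_poly p)" and ?t = "pcompose t (aff_poly p)"
      have "?s * norm_poly + ?t = s * norm_poly + t"
        using less.prems invariant_norm_poly p r by (metis pcompose_add pcompose_mult)
      then have e: "(?s - s) * norm_poly = t - ?t" by (simp add: algebra_simps)
      have dt: "degree ?t = degree t"
        using fst_nz[OF p] by (simp add: degree_pcompose aff_poly_def)
      \<comment> \<open>A non-zero left side of \<open>e\<close> would have degree at least
        \<open>card P\<close>, more than a difference of remainders can have.\<close>
      have "?s - s = 0"
      proof (rule ccontr)
        assume nz: "?s - s \<noteq> 0"
        then have "card P \<le> degree (t - ?t)" 
          using e degree_norm_poly norm_poly_nz by (metis degree_mult_eq le_add2)
        moreover have "degree (t - ?t) \<le> degree t" using dt by (intro degree_diff_le) auto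
        moreover have "t - ?t \<noteq> 0" using e nz norm_poly_nz by (metis mult_eq_0_iff)
        ultimately show False using t by auto
      qed
      then show ?thesis using e by simp
    qed
    have "degree t = 0"
    proof (cases "t = 0")
      case False
      then show ?thesis using st t by (intro invariant_small_degree) auto
    qed simp
    then obtain a where a: "t = [:a:]" by (rule degree_eq_zeroE)
    have "degree s < degree r"
    proof (cases "s = 0")
      case False
      have "degree (s * norm_poly + t) = degree (s * norm_poly)"
        using False norm_poly_nz card_P_pos
        by (intro degree_add_eq_left) (simp add: a degree_mult_eq degree_norm_poly)
      then show ?thesis
        using False norm_poly_nz card_P_pos r by (simp add: degree_mult_eq degree_norm_poly)
    qed (use \<open>degree r \<noteq> 0\<close> in auto)
    then obtain h where "s = pcompose h norm_poly" using less.hyps st by blast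
    then have "r = pcompose (h * [:0, 1:] + [:a:]) norm_poly"
      using r a by (simp add: pcompose_add pcompose_mult pcompose_pCons)
    then show ?thesis by blast
  qed
qed

section \<open>Linear parts and translations\<close>

sublocale units: finite_units "fst ` P"
proof
  show "1 \<in> fst ` P" using one_P by force
  show "0 \<notin> fst ` P" using fst_nz by auto
  show "x * y \<in> fst ` P" if "x \<in> fst ` P" "y \<in> fst ` P" for x y
    using that mult_P by (force simp: aff_mult_def)
qed (simp add: finite_P)

text \<open>The maps with linear part \<open>a\<close> form a coset of the translation
  subgroup.\<close>

lemma card_fibre_fst:
  assumes "a \<in> fst ` P" shows "card {p \<in> P. fst p = a} = card B"
proof -
  obtain b where b: "(a, b) \<in> P" using assms by force
  obtain q where q: "q \<in> P" "aff_mult (a, b) q = (1, 0)" "aff_mult q (a, b) = (1, 0)"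
    using inverse_ex[OF b] .
  have "bij_betw (\<lambda>c. (a, c + b)) B {p \<in> P. fst p = a}"
  proof (rule bij_betwI[where g = "\<lambda>p. snd p - b"])
    show "(\<lambda>c. (a, c + b)) \<in> B \<rightarrow> {p \<in> P. fst p = a}"
      using mult_P[OF _ b] by (force simp: B_def aff_mult_def add.commute)
    show "(\<lambda>p. snd p - b) \<in> {p \<in> P. fst p = a} \<rightarrow> B"
    proof
      fix p assume p: "p \<in> {p \<in> P. fst p = a}"
      have "aff_mult p q = (1, snd p - b)"
        using p q(2) by (auto simp: aff_mult_def algebra_simps add_eq_0_iff)
      then show "snd p - b \<in> B" using mult_P[of p q] p q by (simp add: B_def)
    qed
  qed auto
  then show ?thesis by (simp add: bij_betw_same_card)
qed

text \<open>Composing one map with the inverse of the other leaves the translation by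
  \<open>b - b'\<close>.\<close>

lemma B_diff: "(a, b) \<in> P \<Longrightarrow> (a, b') \<in> P \<Longrightarrow> b - b' \<in> B"
proof -
  assume b: "(a, b) \<in> P" "(a, b') \<in> P"
  obtain q where q: "q \<in> P" "aff_mult (a, b') q = (1, 0)"
    using inverse_ex[OF b(2)] by metis
  have "aff_mult (a, b) q = (1, b - b')"
    using q(2) by (auto simp: aff_mult_def algebra_simps add_eq_0_iff)
  then show ?thesis using mult_P[OF b(1) q(1)] by (simp add: B_def)
qed

lemma card_P_eq: "card P = card (fst ` P) * card B"
  by (rule card_const_fibres) (use finite_P card_fibre_fst in auto)

lemma finite_B: "finite B"
  by (rule finite_subset[of _ "snd ` P"]) (force simp: B_def finite_P)+

lemma zero_B: "0 \<in> B" using one_P by (simp add: B_def)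

lemma uminus_B: "b \<in> B \<Longrightarrow> - b \<in> B"
  using B_diff[of 1 0 b] one_P by (simp add: B_def)

lemma add_B: "b \<in> B \<Longrightarrow> c \<in> B \<Longrightarrow> b + c \<in> B"
  using mult_P[of "(1, b)" "(1, c)"] by (simp add: B_def aff_mult_def add.commute)

text \<open>Translations form a normal subgroup: conjugation by a map with linear part
  \<open>a\<close> multiplies the shift by \<open>a\<close>.\<close>

lemma mult_B:
  assumes "a \<in> fst ` P" "b \<in> B" shows "a * b \<in> B"
proof -
  obtain c where c: "(a, c) \<in> P" using assms by force
  have "aff_mult (a, c) (1, b) = (a, a * b + c)" by (simp add: aff_mult_def)
  then have "(a, a * b + c) \<in> P" using mult_P[OF c, of "(1, b)"] assms by (simp add: B_def)
  from B_diff[OF this c] show ?thesis by simp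
qed

text \<open>Multiplication by \<open>1 - a\<close> is injective on the finite set \<open>B\<close>, hence onto.\<close>
lemma B_cancel:
  assumes "a \<in> fst ` P" "a \<noteq> 1" "(1 - a) * b \<in> B" shows "b \<in> B"
proof -
  have "(*) (1 - a) ` B = B"
  proof (rule endo_inj_surj[OF finite_B])
    show "(*) (1 - a) ` B \<subseteq> B"
    proof safe
      fix c assume "c \<in> B"
      then show "(1 - a) * c \<in> B"
        using add_B[OF _ uminus_B[OF mult_B[OF assms(1)]], of c c] by (simp add: algebra_simps)
    qed
    show "inj_on ((*) (1 - a)) B" using assms by (auto simp: inj_on_def)
  qed
  then show ?thesis using assms by (auto simp: image_iff set_eq_iff) (metis mult_left_cancel right_minus_eq)
qed

text \<open>Negation fixes only \<open>0\<close> on \<open>B\<close>.\<close>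
lemma odd_card_B:
  assumes "(2::'a) \<noteq> 0" shows "odd (card B)"
proof -
  have "even (card (B - {0}))"
  proof (rule even_card_involution[where h = uminus])
    fix x assume "x \<in> B - {0}"
    moreover have "- x \<noteq> x" if "x \<noteq> 0"
    proof
      assume "- x = x"
      then have "2 * x = 0" by (metis add.left_inverse mult_2)
      then show False using that assms by simp
    qed
    ultimately show "- x \<in> B - {0} \<and> - x \<noteq> x \<and> - (- x) = x" using uminus_B by auto
  qed (use finite_B in auto)
  then show ?thesis using zero_B finite_B by (auto simp: card_Diff_singleton card_gt_0_iff)
qed

text \<open>Each linear part occurs \<open>card B\<close> times, so \<open>lead\<close> is a power
  of the product over a finite group of units, which \<open>prod_eq\<close> evaluates.\<close>

lemma lead_eq:
  assumes "(2::'a) \<noteq> 0" shows "lead = (- 1) ^ (card P + 1)"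
proof -
  have "lead = (\<Prod>x\<in>fst ` P. x) ^ card B"
    unfolding lead_def by (rule prod_const_fibres[of P fst _ "\<lambda>x. x"]) (use finite_P card_fibre_fst in auto)
  also have "\<dots> = (- 1) ^ ((card (fst ` P) + 1) * card B)" by (simp only: units.prod_eq power_mult)
  \<comment> \<open>As \<open>card B\<close> is odd, (n + 1) times \<open>card B\<close> and n times
    \<open>card B\<close> plus 1 have the same parity, n being the number of linear parts.\<close>
  also have "\<dots> = (- 1) ^ (card P + 1)"
    using odd_card_B[OF assms] by (auto simp: card_P_eq minus_one_power_iff)
  finally show ?thesis .
qed

lemma fst_power_card: "p \<in> P \<Longrightarrow> fst p ^ card P = 1"
  by (simp add: card_P_eq power_mult units.power_card)

section \<open>Fibres of the norm polynomial\<close>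

lemma norm_poly_minus:
  "norm_poly - [:poly norm_poly x:] = Polynomial.smult lead (\<Prod>p\<in>P. [:- aff_act p x, 1:])"
proof -
  define Q where "Q = (\<Prod>p\<in>P. [:- aff_act p x, 1:])"
  define D where "D = norm_poly - Polynomial.smult lead Q"
  have dQ: "degree Q = card P" unfolding Q_def by (subst degree_prod_eq_sum_degree) auto
  have lQ: "lead_coeff Q = 1" by (simp add: Q_def lead_coeff_prod)
  have Q: "pcompose Q (aff_poly q) = Q" if q: "q \<in> P" for q
  proof -
    have "pcompose Q (aff_poly q) = (\<Prod>p\<in>P. [:snd q - aff_act p x, fst q:])"
      by (simp add: Q_def pcompose_prod pcompose_pCons aff_poly_def)
    also have "\<dots> = (\<Prod>p\<in>P. [:snd q - aff_act (aff_mult q p) x, fst q:])"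
      by (rule prod_left[OF q])
    also have "\<dots> = (\<Prod>p\<in>P. [:fst q:] * [:- aff_act p x, 1:])"
      by (intro prod.cong refl) (simp only: aff_act_mult, simp add: aff_act_def algebra_simps)
    also have "\<dots> = [:fst q:] ^ card P * Q" unfolding Q_def by (simp only: prod.distrib prod_constant)
    \<comment> \<open>Substitution only rescales \<open>Q\<close>, and the factor is 1 by
      \<open>fst_power_card\<close>.\<close>
    also have "\<dots> = Q" by (simp add: poly_const_pow fst_power_card q)
    finally show ?thesis .
  qed
  \<comment> \<open>The leading terms cancel, so \<open>D\<close> is an invariant of degree below
    \<open>card P\<close>, hence a constant; its value is found at the root \<open>x\<close> of
    \<open>Q\<close>.\<close>
  have "coeff D (card P) = 0"
    using lQ lead_coeff_norm_poly by (simp add: D_def dQ degree_norm_poly)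
  moreover have "degree D \<le> card P"
    unfolding D_def by (intro degree_diff_le) (auto simp: dQ degree_norm_poly)
  ultimately have "degree D < card P"
    using card_P_pos by (metis degree_0 le_neq_implies_less leading_coeff_0_iff)
  moreover have "invariant D" using Q invariant_norm_poly by (simp add: D_def pcompose_diff pcompose_smult)
  ultimately have "degree D = 0" by (rule invariant_small_degree[rotated])
  then obtain a where a: "D = [:a:]" by (rule degree_eq_zeroE)
  have "poly Q x = 0" using finite_P one_P by (auto simp: Q_def poly_prod aff_act_def intro!: bexI[of _ "(1, 0)"])
  then have "a = poly norm_poly x" using arg_cong[OF a, of "\<lambda>p. poly p x"] by (simp add: D_def)
  then show ?thesis using a by (simp add: D_def Q_def algebra_simps)
qed

section \<open>Orbits and stabilizers\<close>

lemma mem_orb: "x \<in> orb x"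
  unfolding orb_def by (rule image_eqI[of _ _ "(1, 0)"]) (auto simp: aff_act_def one_P)

lemma finite_orb: "finite (orb x)"
  by (simp add: orb_def finite_P)

lemma orb_subset: "y \<in> orb x \<Longrightarrow> orb y \<subseteq> orb x"
  unfolding orb_def by (auto simp: aff_act_mult[symmetric] mult_P)

lemma orb_sym: "y \<in> orb x \<Longrightarrow> x \<in> orb y"
proof -
  assume "y \<in> orb x"
  then obtain p where p: "p \<in> P" "y = aff_act p x" by (auto simp: orb_def)
  obtain q where q: "q \<in> P" "aff_mult q p = (1, 0)" using inverse_ex[OF p(1)] by metis
  then have "aff_act q y = x" by (simp add: p aff_act_mult[symmetric]) (simp add: aff_act_def)
  then show ?thesis using q by (auto simp: orb_def)
qed

lemma orb_eq: "y \<in> orb x \<Longrightarrow> orb y = orb x"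
  using orb_subset orb_sym by blast

text \<open>Left multiplication by an element carrying \<open>x\<close> to \<open>y\<close> maps the
  stabilizer of \<open>x\<close> bijectively onto the fibre over \<open>y\<close>.\<close>

lemma card_fibre_act:
  assumes "y \<in> orb x"
  shows "card {p \<in> P. aff_act p x = y} = card {p \<in> P. aff_act p x = x}"
proof -
  obtain p where p: "p \<in> P" "y = aff_act p x" using assms by (auto simp: orb_def)
  obtain q where q: "q \<in> P" "aff_mult p q = (1, 0)" "aff_mult q p = (1, 0)" using inverse_ex[OF p(1)] .
  have one: "aff_act (1, 0) z = z" for z :: 'a by (simp add: aff_act_def)
  have qp: "aff_act q (aff_act p z) = z" "aff_act p (aff_act q z) = z" for z
    using one[of z] q by (simp_all add: aff_act_mult[symmetric])
  have "aff_mult p ` {p \<in> P. aff_act p x = x} = {p \<in> P. aff_act p x = y}"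
  proof safe
    fix r assume r: "r \<in> P" "y = aff_act r x"
    show "r \<in> aff_mult p ` {r \<in> P. aff_act r x = x}"
    proof (rule image_eqI[of _ _ "aff_mult q r"])
      have "aff_mult p (aff_mult q r) = aff_mult (aff_mult p q) r"
        by (simp add: aff_mult_def algebra_simps)
      then show "r = aff_mult p (aff_mult q r)" by (simp add: q) (simp add: aff_mult_def)
      show "aff_mult q r \<in> {r \<in> P. aff_act r x = x}"
        using r p q qp(1)[of x] by (auto simp: mult_P aff_act_mult)
    qed
  qed (auto simp: mult_P p aff_act_mult)
  then show ?thesis using card_image[OF inj_left[OF p(1)], of "{p \<in> P. aff_act p x = x}"] by simp
qed

lemma prod_act:
  fixes F :: "'a \<Rightarrow> 'b::comm_semiring_1"
  shows "(\<Prod>p\<in>P. F (aff_act p x)) = (\<Prod>v\<in>orb x. F v) ^ card {p \<in> P. aff_act p x = x}"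
  unfolding orb_def
  by (rule prod_const_fibres[of P "\<lambda>p. aff_act p x" _ F]) (use finite_P card_fibre_act in \<open>auto simp: orb_def\<close>)

lemma orbit_stabilizer: "card P = card (orb x) * card {p \<in> P. aff_act p x = x}"
  unfolding orb_def by (rule card_const_fibres) (use finite_P card_fibre_act in \<open>auto simp: orb_def\<close>)

section \<open>Points with non-trivial stabilizer\<close>

lemma stabilizer_trivial: "x \<notin> W \<Longrightarrow> {p \<in> P. aff_act p x = x} = {(1, 0)}"
  using one_P by (auto simp: W_def aff_act_def)

lemma fixed_fst_neq_1: "p \<noteq> (1, 0) \<Longrightarrow> aff_act p x = x \<Longrightarrow> fst p \<noteq> 1"
  by (cases p) (auto simp: aff_act_def)

text \<open>The equation ax + b = x has the solution b / (1 - a), so every map other than a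
  translation contributes a point of \<open>W\<close>.\<close>

lemma W_I:
  assumes "p \<in> P" "fst p \<noteq> 1" 
  shows "snd p / (1 - fst p) \<in> W" "aff_act p (snd p / (1 - fst p)) = snd p / (1 - fst p)"
proof -
  show *: "aff_act p (snd p / (1 - fst p)) = snd p / (1 - fst p)"
    using assms by (simp add: aff_act_def field_simps)
  have "p \<noteq> (1, 0)" using assms by auto
  then show "snd p / (1 - fst p) \<in> W" unfolding W_def using assms(1) * by blast
qed

text \<open>Let \<open>p\<close> fix \<open>u\<close> with linear part z, which is not 1. For
  \<open>h\<close> in \<open>P\<close> the two composites of \<open>h\<close> and \<open>p\<close>
  have the same linear part, so their constant terms differ by an element of \<open>B\<close>. This
  difference is (1 - z)(h(u) - u), and \<open>B_cancel\<close> puts h(u) - u into \<open>B\<close>.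
  The same cancellation compares \<open>u\<close> with any other point of \<open>W\<close>.\<close>

lemma W_orbit:
  assumes u: "u \<in> W" shows "orb u = W" and "W = (\<lambda>b. u + b) ` B"
proof -
  obtain p where p: "p \<in> P" "p \<noteq> (1, 0)" "aff_act p u = u" using u by (auto simp: W_def)
  obtain z z0 where pz: "p = (z, z0)" by (cases p)
  have z: "z \<noteq> 1" "z \<in> fst ` P" using fixed_fst_neq_1[OF p(2,3)] p pz by force+
  have z0: "z0 = (1 - z) * u" using p pz by (simp add: aff_act_def algebra_simps)
  have 1: "aff_act h u - u \<in> B" if h: "h \<in> P" for h
  proof -
    obtain a c where hc: "h = (a, c)" by (cases h)
    have "aff_mult h p = (z * a, a * z0 + c)" "aff_mult p h = (z * a, z * c + z0)"
      by (auto simp: hc pz aff_mult_def)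
    then have "(a * z0 + c) - (z * c + z0) \<in> B" using B_diff mult_P h p by metis
    then have "(1 - z) * (aff_act h u - u) \<in> B" by (simp add: hc z0 aff_act_def algebra_simps)
    then show ?thesis by (rule B_cancel[OF z(2,1)])
  qed
  have 2: "orb u \<subseteq> (\<lambda>b. u + b) ` B"
    using 1 by (force simp: orb_def)
  have 3: "(\<lambda>b. u + b) ` B \<subseteq> orb u"
    by (auto simp: orb_def B_def aff_act_def add.commute intro!: image_eqI[of _ _ "(1, _)"])
  have 4: "W \<subseteq> (\<lambda>b. u + b) ` B"
  proof
    fix v assume "v \<in> W"
    then obtain h where h: "h \<in> P" "h \<noteq> (1, 0)" "aff_act h v = v" by (auto simp: W_def)
    obtain a c where hc: "h = (a, c)" by (cases h)
    have a: "a \<noteq> 1" "a \<in> fst ` P" using fixed_fst_neq_1[OF h(2,3)] h hc by force+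
    have "(1 - a) * (v - u) = aff_act h u - u"
      using h(3) by (simp add: hc aff_act_def algebra_simps)
    then have "v - u \<in> B" using 1[OF h(1)] B_cancel[OF a(2,1)] by metis
    then show "v \<in> (\<lambda>b. u + b) ` B" by force
  qed
  have 5: "(\<lambda>b. u + b) ` B \<subseteq> W"
  proof safe
    fix b assume b: "b \<in> B"
    \<comment> \<open>Conjugating \<open>p\<close> by the translation by \<open>b\<close> moves its
      fixed point \<open>u\<close> to \<open>u + b\<close>.\<close>
    define q where "q = aff_mult (1, b) (aff_mult p (1, - b))"
    have "q \<in> P" using b uminus_B[OF b] p by (auto simp: q_def B_def mult_P)
    moreover have "fst q \<noteq> 1" using z by (simp add: q_def aff_mult_def pz)
    moreover have "aff_act q (u + b) = u + b"
      using p(3) by (simp add: q_def aff_act_mult) (simp add: aff_act_def add.commute)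
    moreover from calculation have "q \<noteq> (1, 0)" by auto
    ultimately show "u + b \<in> W" unfolding W_def by blast
  qed
  show "W = (\<lambda>b. u + b) ` B" using 4 5 by blast
  then show "orb u = W" using 2 3 by blast
qed

lemma card_W: "W \<noteq> {} \<Longrightarrow> card W = card B"
  using W_orbit(2) by (metis card_image ex_in_conv inj_on_add)

lemma finite_W: "finite W"
  by (cases "W = {}") (use W_orbit(1) finite_orb in \<open>auto, metis\<close>)

text \<open>Orbit-stabilizer: the orbit \<open>W\<close> has \<open>card B\<close> points, and
  \<open>card P\<close> is \<open>card B\<close> times the number of linear parts.\<close>

lemma card_stabilizer_W:
  assumes "u \<in> W" shows "card {p \<in> P. aff_act p u = u} = card (fst ` P)"
proof -
  have "card B * card {p \<in> P. aff_act p u = u} = card B * card (fst ` P)"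
    using orbit_stabilizer[of u] card_P_eq W_orbit(1)[OF assms] card_W assms
    by (simp add: mult.commute) (metis empty_iff)
  moreover have "card B \<noteq> 0" using finite_B zero_B by auto
  ultimately show ?thesis by simp
qed

text \<open>Compare the product of the differences \<open>z - u\<close> over \<open>Z - {u}\<close> before and after applying \<open>p\<close>.\<close>
lemma fst_power_stable:
  assumes "finite Z" "p \<in> P" "aff_act p u = u" "\<And>z. z \<in> Z \<Longrightarrow> aff_act p z \<in> Z"
  shows "fst p ^ card (Z - {u}) = 1"
proof -
  have inj: "inj_on (aff_act p) S" for S using fst_nz[OF assms(2)] by (auto simp: inj_on_def aff_act_def)
  have "aff_act p ` (Z - {u}) = Z - {u}"
  proof (rule endo_inj_surj[OF _ _ inj])
    show "aff_act p ` (Z - {u}) \<subseteq> Z - {u}"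
    proof (intro image_subsetI)
      fix z assume "z \<in> Z - {u}"
      then show "aff_act p z \<in> Z - {u}" using assms(3,4) inj_eq[OF inj, of z u] by auto
    qed
  qed (use assms(1) in auto)
  then have "(\<Prod>z\<in>Z - {u}. z - u) = (\<Prod>z\<in>Z - {u}. aff_act p z - u)"
    using prod.reindex[OF inj, of "\<lambda>z. z - u" "Z - {u}"] by simp
  also have "\<dots> = (\<Prod>z\<in>Z - {u}. fst p * (z - u))"
  proof (intro prod.cong refl)
    fix z 
    have "aff_act p z - u = aff_act p z - aff_act p u" by (simp add: assms)
    also have "\<dots> = fst p * (z - u)" by (simp add: aff_act_def algebra_simps)
    finally show "aff_act p z - u = fst p * (z - u)" .
  qed
  also have "\<dots> = fst p ^ card (Z - {u}) * (\<Prod>z\<in>Z - {u}. z - u)" by (simp add: prod.distrib)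
  finally show ?thesis using assms(1) by auto
qed

section \<open>Orbit polynomials and the norm\<close>

text \<open>Its value at the coordinate X of the curve will be \<open>I\<^sub>T\<close>.\<close>

definition trans_poly :: "'a poly" where
  "trans_poly = (\<Prod>b\<in>B. [:b, 1:])"

text \<open>For every \<open>z\<close> in \<open>W\<close> the set \<open>W\<close> is z + B, so
  \<open>trans_poly\<close> takes the value \<open>\<Prod>W\<close> at \<open>z\<close>.\<close>

lemma trans_poly_minus:
  assumes "W \<noteq> {}" shows "trans_poly - [:\<Prod>W:] = (\<Prod>w\<in>W. [:- w, 1:])"
proof (rule prod_linear_eqI[OF finite_W])
  have d: "degree trans_poly = card B"
    unfolding trans_poly_def by (subst degree_prod_eq_sum_degree) auto
  have l: "lead_coeff trans_poly = 1" by (simp add: trans_poly_def lead_coeff_prod)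
  have "card B > 0" using finite_B zero_B by (auto simp: card_gt_0_iff)
  moreover from this have "degree (trans_poly + - [:\<Prod>W:]) = degree trans_poly"
    by (intro degree_add_eq_left) (simp add: d)
  moreover from calculation have "lead_coeff (trans_poly + - [:\<Prod>W:]) = lead_coeff trans_poly"
    using d by (cases "card B") auto
  ultimately show "degree (trans_poly - [:\<Prod>W:]) = card W" "lead_coeff (trans_poly - [:\<Prod>W:]) = 1"
    using d l card_W[OF assms] by (simp_all only: diff_conv_add_uminus)
  fix z assume "z \<in> W"
  then have "\<Prod>W = (\<Prod>b\<in>B. z + b)"
    using W_orbit(2) prod.reindex[of "\<lambda>b. z + b" B "\<lambda>x. x"] by (simp add: inj_on_def)
  then show "poly (trans_poly - [:\<Prod>W:]) z = 0" by (simp add: trans_poly_def poly_prod add.commute)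
qed

lemma poly_norm_poly: "poly norm_poly x = (\<Prod>p\<in>P. aff_act p x)"
  by (simp add: norm_poly_def poly_prod)

text \<open>With trivial stabilizer every point of the orbit is hit once, so the value of
  \<open>norm_poly\<close> at \<open>x\<close> is the product over the orbit.\<close>

lemma norm_poly_minus_orbit:
  assumes "x \<notin> W"
  shows "norm_poly - [:\<Prod>(orb x):] = Polynomial.smult lead (\<Prod>v\<in>orb x. [:- v, 1:])"
proof -
  have "poly norm_poly x = \<Prod>(orb x)"
    using prod_act[of "\<lambda>v. v" x] stabilizer_trivial[OF assms] by (simp add: poly_norm_poly)
  then show ?thesis
    using norm_poly_minus[of x] prod_act[of "\<lambda>v. [:- v, 1:]" x] stabilizer_trivial[OF assms] by simp
qed

text \<open>Every point of \<open>W\<close> is hit as often as there are linear parts; this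
  multiplicity is the m of the theorem.\<close>

lemma norm_poly_minus_W:
  assumes "W \<noteq> {}"
  shows "norm_poly - [:\<Prod>W ^ card (fst ` P):]
    = Polynomial.smult lead ((\<Prod>w\<in>W. [:- w, 1:]) ^ card (fst ` P))"
proof -
  obtain u where u: "u \<in> W" using assms by blast
  have "poly norm_poly u = \<Prod>W ^ card (fst ` P)"
    using prod_act[of "\<lambda>v. v" u] card_stabilizer_W[OF u] W_orbit(1)[OF u] by (simp add: poly_norm_poly)
  then show ?thesis
    using norm_poly_minus[of u] prod_act[of "\<lambda>v. [:- v, 1:]" u] card_stabilizer_W[OF u] W_orbit(1)[OF u]
    by simp
qed

section \<open>Stable sets as unions of orbits\<close>

lemma orbits_disjoint: "disjoint (orb ` R)"
  using orb_eq by (auto simp: disjoint_def) blast+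

lemma Union_orbits:
  assumes "\<And>p r. p \<in> P \<Longrightarrow> r \<in> R \<Longrightarrow> aff_act p r \<in> R"
  shows "\<Union>(orb ` R) = R"
  using mem_orb assms by (auto simp: orb_def)

lemma prod_orbits:
  assumes "\<And>p r. p \<in> P \<Longrightarrow> r \<in> R \<Longrightarrow> aff_act p r \<in> R"
  shows "(\<Prod>r\<in>R. F r) = (\<Prod>Q\<in>orb ` R. \<Prod>r\<in>Q. F r)"
  using prod.Union_disjoint[of "orb ` R" F] finite_orb orbits_disjoint[of R] Union_orbits[OF assms]
  by (auto simp: disjoint_def)

lemma W_subset_or_disjoint:
  assumes "\<And>p r. p \<in> P \<Longrightarrow> r \<in> R \<Longrightarrow> aff_act p r \<in> R"
  shows "W \<subseteq> R \<or> W \<inter> R = {}"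
proof (rule disjCI)
  assume "W \<inter> R \<noteq> {}"
  then obtain u where "u \<in> W" "u \<in> R" by blast
  then have "orb u \<subseteq> R" using assms by (auto simp: orb_def simp del: split_paired_All)
  then show "W \<subseteq> R" using W_orbit(1)[OF \<open>u \<in> W\<close>] by simp
qed

text \<open>If \<open>p\<close> is not a translation, its fixed point lies in \<open>W\<close> and
  \<open>p\<close> permutes \<open>W\<close>, so \<open>fst_power_stable\<close> applies with
  exponent \<open>card W\<close> - 1.\<close>

lemma fst_power_card_W:
  assumes "p \<in> P" shows "W \<noteq> {} \<Longrightarrow> fst p ^ card W = fst p"
proof (cases "fst p = 1")
  case False
  note u = W_I[OF assms False]
  have "fst p ^ card (W - {snd p / (1 - fst p)}) = 1"
    using W_orbit(1) by (intro fst_power_stable finite_W assms u) (use assms in \<open>auto simp: orb_def\<close>)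
  then show ?thesis using card.remove[OF finite_W u(1)] by simp
qed simp

text \<open>A map with linear part other than 1 has its fixed point in \<open>W\<close>, hence in
  \<open>R\<close> exactly if \<open>W \<subseteq> R\<close>; this decides whether the exponent with
  value 1 is \<open>card R\<close> - 1 or \<open>card R\<close>. If \<open>W\<close> is empty, all
  linear parts are 1 and the branches agree.\<close>

lemma fst_power_card_stable:
  assumes "finite R" "\<And>p r. p \<in> P \<Longrightarrow> r \<in> R \<Longrightarrow> aff_act p r \<in> R" and p: "p \<in> P"
  shows "fst p ^ card R = (if W \<subseteq> R then fst p else 1)"
proof (cases "fst p = 1")
  case False
  note u = W_I[OF p False]
  have *: "fst p ^ card (R - {snd p / (1 - fst p)}) = 1"
    by (intro fst_power_stable assms u) auto
  show ?thesis
  proof (cases "W \<subseteq> R")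
    case True
    then have "card R = Suc (card (R - {snd p / (1 - fst p)}))"
      using u assms(1) by (intro card.remove) auto
    then show ?thesis using * True by simp
  next
    case False
    then have "R - {snd p / (1 - fst p)} = R" using u W_subset_or_disjoint[OF assms(2)] by auto
    then show ?thesis using * False by simp
  qed
qed simp

lemma pcompose_orbit_poly:
  assumes "r \<notin> W"
  shows "pcompose [:- \<Prod>(orb r), 1:] norm_poly = Polynomial.smult lead (\<Prod>v\<in>orb r. [:- v, 1:])"
  using norm_poly_minus_orbit[OF assms] by (simp add: pcompose_pCons diff_conv_add_uminus add.commute del: add_uminus_conv_diff)

lemma pcompose_regular_orbits:
  assumes "S \<subseteq> orb ` (- W)" 
  shows "pcompose (\<Prod>Q\<in>S. [:- (\<Prod>r\<in>Q. r), 1:]) norm_poly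
    = Polynomial.smult (lead ^ card S) (\<Prod>Q\<in>S. \<Prod>r\<in>Q. [:- r, 1:])"
proof -
  have "pcompose (\<Prod>Q\<in>S. [:- (\<Prod>r\<in>Q. r), 1:]) norm_poly = (\<Prod>Q\<in>S. pcompose [:- (\<Prod>r\<in>Q. r), 1:] norm_poly)"
    by (rule pcompose_prod)
  also have "\<dots> = (\<Prod>Q\<in>S. [:lead:] * (\<Prod>r\<in>Q. [:- r, 1:]))"
    using assms by (intro prod.cong refl) (auto simp: pcompose_orbit_poly )
  also have "\<dots> = [:lead:] ^ card S * (\<Prod>Q\<in>S. \<Prod>r\<in>Q. [:- r, 1:])"
    by (simp only: prod.distrib prod_constant)
  finally show ?thesis by (simp add: poly_const_pow)
qed

lemma card_regular_orbits:
  assumes "finite R" "\<And>p r. p \<in> P \<Longrightarrow> r \<in> R \<Longrightarrow> aff_act p r \<in> R" "W \<inter> R = {}"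
  shows "card R = card (orb ` R) * card P"
proof -
  have "card (orb r) = card P" if "r \<in> R" for r
  proof -
    have "r \<notin> W" using that assms(3) by auto
    then show ?thesis using orbit_stabilizer[of r] stabilizer_trivial[of r] by simp
  qed
  then have "card Q = card P" if "Q \<in> orb ` R" for Q using that by auto
  then have "card (\<Union>(orb ` R)) = card (orb ` R) * card P"
    using orbits_disjoint finite_orb assms(1) by (subst card_Union_disjoint) auto
  then show ?thesis using Union_orbits[OF assms(2)] by simp
qed

text \<open>All orbits in \<open>R\<close> are regular, so the product is a pull-back along the norm
  up to one factor \<open>lead\<close> for each orbit.\<close>

lemma roots_poly_regular:
  assumes two: "(2::'a) \<noteq> 0" and R: "finite R" "\<And>p r. p \<in> P \<Longrightarrow> r \<in> R \<Longrightarrow> aff_act p r \<in> R"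
    and disj: "W \<inter> R = {}"
  shows "(\<Prod>r\<in>R. [:- r, 1:]) = Polynomial.smult ((- 1) ^ (card R - card (orb ` R)))
    (pcompose (\<Prod>Q\<in>orb ` R. [:- (\<Prod>r\<in>Q. r), 1:]) norm_poly)"
proof -
  have "orb ` R \<subseteq> orb ` (- W)" using disj by auto
  note 1 = pcompose_regular_orbits[OF this]
  \<comment> \<open>Every orbit has \<open>card P\<close> points, so the exponent amounts to one
    sign (-1)^(card P - 1) for each orbit, which cancels \<open>lead\<close>.\<close>
  have "card R - card (orb ` R) = card (orb ` R) * (card P - 1)"
    using card_regular_orbits[OF R disj] by (simp add: algebra_simps)
  moreover have "(- 1) ^ (card (orb ` R) * (card P - 1)) * lead ^ card (orb ` R) = 1"
    using card_P_pos by (cases "card P") (auto simp: lead_eq[OF two] minus_one_power_iff simp flip: power_mult)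
  ultimately show ?thesis using 1 prod_orbits[OF R(2), where F = "\<lambda>r. [:- r, 1:]"] by simp
qed

text \<open>The polynomial of \<open>W\<close> divides the product over \<open>R\<close> once if
  \<open>n\<close> is odd and does not occur if \<open>n\<close> is even. The even power in front
  completes it to the \<open>n\<close>-th power, a pull-back by \<open>norm_poly_minus_W\<close>;
  all other orbits are regular.\<close>

lemma roots_poly_twisted:
  assumes two: "(2::'a) \<noteq> 0" and R: "finite R" "\<And>p r. p \<in> P \<Longrightarrow> r \<in> R \<Longrightarrow> aff_act p r \<in> R"
    and "R \<noteq> {}" and W: "W \<noteq> {}" and n: "n = card (fst ` P)"
    and parity: "W \<inter> R = {} \<Longrightarrow> even n" "W \<subseteq> R \<Longrightarrow> odd n"
  shows "(trans_poly - [:\<Prod>W:]) ^ (2 * (n div 2)) * (\<Prod>r\<in>R. [:- r, 1:])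
    = Polynomial.smult ((- 1) ^ ((n - 1) * (card (orb ` R) - 1)))
       (pcompose ([:- (\<Prod>W ^ n), 1:] * (\<Prod>Q\<in>orb ` R - {W}. [:- (\<Prod>r\<in>Q. r), 1:])) norm_poly)"
proof -
  define fW where "fW = (\<Prod>w\<in>W. [:- w, 1:])"
  define k where "k = card (orb ` R)"
  define h where "h = (\<Prod>Q\<in>orb ` R - {W}. \<Prod>r\<in>Q. [:- r, 1:])"
  have k: "k > 0" using \<open>R \<noteq> {}\<close> R(1) by (auto simp: k_def card_gt_0_iff)
  have n0: "n > 0" using finite_P one_P by (auto simp: n card_gt_0_iff)
  have regular: "orb ` R - {W} \<subseteq> orb ` (- W)" using W_orbit(1) by auto
  have "pcompose [:- (\<Prod>W ^ n), 1:] norm_poly = Polynomial.smult lead (fW ^ n)"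
    using norm_poly_minus_W[OF W]
    by (simp add: pcompose_pCons n fW_def diff_conv_add_uminus add.commute del: add_uminus_conv_diff)
  then have 1: "pcompose ([:- (\<Prod>W ^ n), 1:] * (\<Prod>Q\<in>orb ` R - {W}. [:- (\<Prod>r\<in>Q. r), 1:])) norm_poly
    = Polynomial.smult (lead ^ (card (orb ` R - {W}) + 1)) (fW ^ n * h)"
    by (simp only: pcompose_mult pcompose_regular_orbits[OF regular] h_def mult_smult_left mult_smult_right)
      (simp add: mult.commute)
  have W_mem: "W \<in> orb ` R \<longleftrightarrow> W \<subseteq> R" 
    using W_subset_or_disjoint[OF R(2)] W_orbit(1) W mem_orb by (auto simp: image_iff) blast+
  show ?thesis
  proof (cases "W \<subseteq> R")
    case True
    then have "odd n" by (rule parity)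
    then have "n = Suc (2 * (n div 2))" by simp
    then have "fW ^ n = fW ^ (2 * (n div 2)) * fW" by (metis power_Suc2)
    moreover have "(\<Prod>r\<in>R. [:- r, 1:]) = fW * h"
      using prod_orbits[OF R(2), where F = "\<lambda>r. [:- r, 1:]"] True W_mem
        prod.remove[of "orb ` R" W "\<lambda>Q. \<Prod>r\<in>Q. [:- r, 1:]"] R(1) by (simp add: fW_def h_def)
    ultimately have "(trans_poly - [:\<Prod>W:]) ^ (2 * (n div 2)) * (\<Prod>r\<in>R. [:- r, 1:]) = fW ^ n * h"
      by (simp add: trans_poly_minus[OF W] fW_def[symmetric])
    moreover have "lead = 1"
      using \<open>odd n\<close> odd_card_B[OF two] by (simp add: lead_eq[OF two] card_P_eq n)
    moreover have "even ((n - 1) * (k - 1))" using \<open>odd n\<close> by simp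
    ultimately show ?thesis unfolding 1 by (simp add: k_def)
  next
    case False
    then have "W \<inter> R = {}" using W_subset_or_disjoint[OF R(2)] by blast
    then have "even n" by (rule parity)
    have e: "orb ` R - {W} = orb ` R" using W_mem False by auto
    have "(trans_poly - [:\<Prod>W:]) ^ (2 * (n div 2)) * (\<Prod>r\<in>R. [:- r, 1:]) = fW ^ n * h"
      using \<open>even n\<close> trans_poly_minus[OF W] prod_orbits[OF R(2), where F = "\<lambda>r. [:- r, 1:]"]
      by (simp add: fW_def h_def e)
    moreover have "lead = - 1"
      using \<open>even n\<close> by (simp add: lead_eq[OF two] card_P_eq n)
    \<comment> \<open>Here \<open>lead\<close> = -1 occurs k + 1 times, once for \<open>W\<close>
      and once for each of the k orbits in \<open>R\<close>; as \<open>n - 1\<close> is odd, the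
      signs cancel.\<close>
    moreover have "(- 1) ^ ((n - 1) * (k - 1)) * (- 1 :: 'a) ^ (k + 1) = 1"
      using \<open>even n\<close> n0 k by (cases k) (auto simp: minus_one_power_iff)
    ultimately show ?thesis unfolding 1[unfolded e] smult_smult e k_def by (simp only: smult_1_left)
  qed
qed

end

section \<open>Generated subfields and rational functions\<close>

context
  fixes R :: "'a::field ring"
  assumes R_def: "R = ring_of_type_algebra"
begin

lemma rta_simps:
  "carrier R = UNIV" "x \<otimes>\<^bsub>R\<^esub> y = x * y" "x \<oplus>\<^bsub>R\<^esub> y = x + y" "\<one>\<^bsub>R\<^esub> = 1" "\<zero>\<^bsub>R\<^esub> = 0"
  by (simp_all add: R_def ring_of_type_algebra_def)

interpretation field R
  unfolding R_def by (rule field_from_type_algebra)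

lemma rta_a_inv: "\<ominus>\<^bsub>R\<^esub> x = - x"
  using minus_equality[of "- x" x] by (simp add: rta_simps)

lemma rta_m_inv: "x \<noteq> 0 \<Longrightarrow> inv\<^bsub>R\<^esub> x = inverse x"
  using inv_unique'[of x "inverse x"] by (simp add: rta_simps)

lemma rta_power: "x [^]\<^bsub>R\<^esub> (n::nat) = x ^ n"
  by (induction n) (simp_all add: rta_simps mult.commute)

lemma rta_eval: "eval ps x = poly (Poly (rev ps)) x"
proof (induction ps)
  case (Cons a ps)
  then show ?case by (simp add: rta_simps rta_power Poly_append poly_monom)
qed (simp add: rta_simps)

text \<open>Polynomials are here coefficient lists with the leading coefficient first, hence the
  reversal; the empty list is the zero polynomial.\<close>

lemma rta_transcendental:
  "transcendental K x \<longleftrightarrow> inj_on (\<lambda>ps. poly (Poly (rev ps)) x) {ps. ps = [] \<or> set ps \<subseteq> K \<and> hd ps \<noteq> 0}"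
  by (simp add: transcendental_def univ_poly_def polynomial_def rta_eval rta_simps)

end

section \<open>Subfields and adjunction\<close>

text \<open>Since \<open>inverse 0 = 0\<close>, closure under inverses can be demanded at every
  element.\<close>

definition subfield_set :: "'K::field set \<Rightarrow> bool" where
  "subfield_set F \<longleftrightarrow> 1 \<in> F \<and> (\<forall>x\<in>F. - x \<in> F \<and> inverse x \<in> F) \<and> (\<forall>x\<in>F. \<forall>y\<in>F. x + y \<in> F \<and> x * y \<in> F)"

lemma subfield_set_closed:
  assumes "subfield_set F"
  shows "1 \<in> F" "0 \<in> F" "x \<in> F \<Longrightarrow> - x \<in> F" "x \<in> F \<Longrightarrow> inverse x \<in> F"
    "x \<in> F \<Longrightarrow> y \<in> F \<Longrightarrow> x + y \<in> F" "x \<in> F \<Longrightarrow> y \<in> F \<Longrightarrow> x * y \<in> F"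
    "x \<in> F \<Longrightarrow> y \<in> F \<Longrightarrow> x - y \<in> F" "x \<in> F \<Longrightarrow> y \<in> F \<Longrightarrow> x / y \<in> F" "x \<in> F \<Longrightarrow> x ^ n \<in> F"
proof -
  show *: "1 \<in> F" "x \<in> F \<Longrightarrow> - x \<in> F" "x \<in> F \<Longrightarrow> inverse x \<in> F"
    "x \<in> F \<Longrightarrow> y \<in> F \<Longrightarrow> x + y \<in> F" "x \<in> F \<Longrightarrow> y \<in> F \<Longrightarrow> x * y \<in> F" for x y
    using assms by (auto simp: subfield_set_def)
  show "0 \<in> F" using *(4)[OF *(1) *(2)[OF *(1)]] by simp
  show "x \<in> F \<Longrightarrow> y \<in> F \<Longrightarrow> x - y \<in> F" using *(4)[OF _ *(2), of x y] by simp
  show "x \<in> F \<Longrightarrow> y \<in> F \<Longrightarrow> x / y \<in> F" using *(5)[OF _ *(3), of x y] by (simp add: divide_inverse)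
  show "x \<in> F \<Longrightarrow> x ^ n \<in> F" by (induction n) (auto simp: *)
qed

lemma subfield_set_adjoin:
  fixes S :: "'K::field set"
  shows "subfield_set (adjoin \<iota> S)"
proof -
  let ?R = "ring_of_type_algebra :: 'K ring"
  note simps = rta_simps[of ?R, OF refl] rta_a_inv[of ?R, OF refl] rta_m_inv[of ?R, OF refl]
  note gen = generate_field.intros[where R = ?R and H = "range \<iota> \<union> S", unfolded simps]
  have "inverse x \<in> adjoin \<iota> S" if "x \<in> adjoin \<iota> S" for x
    using gen(4)[of x] that simps(7)[of x] by (cases "x = 0") (auto simp: adjoin_def)
  then show ?thesis using gen(1,3,5,6) by (auto simp: subfield_set_def adjoin_def)
qed

lemma adjoin_incl: "\<iota> a \<in> adjoin \<iota> S" "x \<in> S \<Longrightarrow> x \<in> adjoin \<iota> S"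
  by (auto simp: adjoin_def intro: generate_field.incl)

lemmas adjoin_closed = subfield_set_closed[OF subfield_set_adjoin]

lemma adjoin_least:
  assumes "subfield_set F" "range \<iota> \<subseteq> F" "S \<subseteq> F"
  shows "adjoin \<iota> S \<subseteq> F"
proof
  fix x assume "x \<in> adjoin \<iota> S"
  then show "x \<in> F" unfolding adjoin_def
  proof (induction rule: generate_field.induct)
    case (m_inv h)
    then show ?case
      by (simp add: rta_simps(5)[OF refl] rta_m_inv[OF refl] subfield_set_closed[OF assms(1)])
  qed (use assms in \<open>auto simp: rta_simps[OF refl] rta_a_inv[OF refl] subfield_set_closed[OF assms(1)]\<close>)
qed

section \<open>Field embeddings acting on polynomials\<close>

locale field_emb =
  fixes \<iota> :: "'k::field \<Rightarrow> 'K::field"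
  assumes emb: "field_embedding \<iota>"
begin

lemma hom_add [simp]: "\<iota> (x + y) = \<iota> x + \<iota> y"
  and hom_mult [simp]: "\<iota> (x * y) = \<iota> x * \<iota> y"
  and hom_1 [simp]: "\<iota> 1 = 1"
  using emb by (auto simp: field_embedding_def ring_hom_def rta_simps[OF refl])

lemma hom_0 [simp]: "\<iota> 0 = 0"
  using hom_add[of 0 0] by (metis add_0 add_left_cancel add.right_neutral)

lemma hom_uminus [simp]: "\<iota> (- x) = - \<iota> x"
  using hom_add[of x "- x"] by (simp add: eq_neg_iff_add_eq_0 add.commute)

lemma hom_diff [simp]: "\<iota> (x - y) = \<iota> x - \<iota> y"
  using hom_add[of x "- y"] by simp

lemma hom_eq_0_iff [simp]: "\<iota> x = 0 \<longleftrightarrow> x = 0"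
  using hom_mult[of x "inverse x"] by (cases "x = 0") (auto simp del: hom_mult)

lemma hom_eq_iff [simp]: "\<iota> x = \<iota> y \<longleftrightarrow> x = y"
  using hom_eq_0_iff[of "x - y"] by simp

lemma hom_power [simp]: "\<iota> (x ^ n) = \<iota> x ^ n"
  by (induction n) auto

lemma hom_prod: "\<iota> (prod f A) = (\<Prod>x\<in>A. \<iota> (f x))"
  by (induction A rule: infinite_finite_induct) auto

lemma map_poly_hom_add: "map_poly \<iota> (p + q) = map_poly \<iota> p + map_poly \<iota> q"
  by (rule poly_eqI) (simp add: coeff_map_poly)

lemma map_poly_hom_smult: "map_poly \<iota> (Polynomial.smult a p) = Polynomial.smult (\<iota> a) (map_poly \<iota> p)"
  by (rule poly_eqI) (simp add: coeff_map_poly)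

lemma map_poly_hom_diff: "map_poly \<iota> (p - q) = map_poly \<iota> p - map_poly \<iota> q"
  by (rule poly_eqI) (simp add: coeff_map_poly)

lemma map_poly_hom_pCons: "map_poly \<iota> (pCons a p) = pCons (\<iota> a) (map_poly \<iota> p)"
  by (rule map_poly_pCons) simp

lemma map_poly_hom_mult: "map_poly \<iota> (p * q) = map_poly \<iota> p * map_poly \<iota> q"
  by (induction p) (simp_all add: map_poly_hom_add map_poly_hom_smult map_poly_hom_pCons)

lemma map_poly_hom_power: "map_poly \<iota> (p ^ n) = map_poly \<iota> p ^ n"
  by (induction n) (simp_all add: map_poly_hom_mult)

lemma map_poly_hom_prod: "map_poly \<iota> (prod f A) = (\<Prod>x\<in>A. map_poly \<iota> (f x))"
  by (induction A rule: infinite_finite_induct) (simp_all add: map_poly_hom_mult)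

lemma map_poly_hom_pcompose: "map_poly \<iota> (pcompose p q) = pcompose (map_poly \<iota> p) (map_poly \<iota> q)"
  by (induction p) (simp_all add: pcompose_pCons map_poly_hom_add map_poly_hom_mult map_poly_hom_pCons)

lemma map_poly_hom_eq_iff: "map_poly \<iota> p = map_poly \<iota> q \<longleftrightarrow> p = q"
  by (auto simp: poly_eq_iff coeff_map_poly)

lemma degree_map_poly_hom: "degree (map_poly \<iota> p) = degree p"
  by (rule degree_map_poly) simp

text \<open>The coefficients of \<open>H\<close> are the digits of \<open>q\<close> to the base
  \<open>N\<close>. Division with remainder is compatible with extension of the field, so these
  digits lie in the small field.\<close>

lemma pcompose_descend:
  assumes "degree N > 0" "pcompose H (map_poly \<iota> N) = map_poly \<iota> q"
  shows "\<exists>h. map_poly \<iota> h = H \<and> q = pcompose h N"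
proof -
  have "\<exists>h. map_poly \<iota> h = H" using assms(2)
  proof (induction H arbitrary: q)
    case 0
    show ?case by (rule exI[of _ 0]) simp
  next
    case (pCons a H)
    let ?N = "map_poly \<iota> N" and ?s = "map_poly \<iota> (q div N)" and ?t = "map_poly \<iota> (q mod N)"
    have "map_poly \<iota> q = ?N * ?s + ?t"
      by (metis map_poly_hom_add map_poly_hom_mult mult_div_mod_eq)
    \<comment> \<open>Two divisions of the same polynomial by \<open>N\<close>: comparing degrees,
      quotients and remainders coincide.\<close>
    with pCons.prems have e: "?N * (pcompose H ?N - ?s) = ?t - [:a:]"
      by (simp add: pcompose_pCons algebra_simps)
    have "degree (q mod N) < degree N"
      using assms(1) degree_mod_less[of N q] by (cases "N = 0") auto
    then have "degree ?t < degree ?N" by (simp add: degree_map_poly_hom)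
    then have "degree (?t - [:a:]) < degree ?N" using assms(1)
      by (intro le_less_trans[OF degree_diff_le_max]) (auto simp: degree_map_poly_hom)
    then have "pcompose H ?N - ?s = 0"
      using e degree_mult_right_le[of "pcompose H ?N - ?s" ?N] by (cases "pcompose H ?N - ?s = 0") auto
    then have H: "pcompose H ?N = ?s" and t: "?t = [:a:]" using e by auto
    from pCons.IH[OF H] obtain h where "map_poly \<iota> h = H" ..
    moreover have "\<iota> (coeff (q mod N) 0) = a" using arg_cong[OF t, of "\<lambda>p. coeff p 0"] by (simp add: coeff_map_poly)
    ultimately have "map_poly \<iota> (pCons (coeff (q mod N) 0) h) = pCons a H" by (simp add: map_poly_hom_pCons)
    then show ?case ..
  qed
  then obtain h where h: "map_poly \<iota> h = H" ..
  then have "map_poly \<iota> (pcompose h N) = map_poly \<iota> q" using assms(2) by (simp add: map_poly_hom_pcompose)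
  then show ?thesis using h by (auto simp: map_poly_hom_eq_iff)
qed

section \<open>Values of polynomials; the fields k(x) and k(x, y)\<close>

definition ev :: "'k poly \<Rightarrow> 'K \<Rightarrow> 'K" where
  "ev p x = poly (map_poly \<iota> p) x"

lemma ev_simps [simp]:
  "ev 0 x = 0" "ev 1 x = 1" "ev (pCons a p) x = \<iota> a + x * ev p x" "ev (p + q) x = ev p x + ev q x"
  "ev (p - q) x = ev p x - ev q x" "ev (p * q) x = ev p x * ev q x" "ev (p ^ n) x = ev p x ^ n"
  "ev (Polynomial.smult a p) x = \<iota> a * ev p x"
  by (simp_all add: ev_def map_poly_hom_add map_poly_hom_mult map_poly_hom_smult map_poly_hom_diff
      map_poly_hom_power map_poly_hom_pCons)

lemma ev_prod: "ev (prod f A) x = (\<Prod>a\<in>A. ev (f a) x)"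
  by (simp add: ev_def map_poly_hom_prod poly_prod)

lemma ev_pcompose [simp]: "ev (pcompose p q) x = ev p (ev q x)"
  by (simp add: ev_def map_poly_hom_pcompose poly_pcompose)

lemma ev_mem: "x \<in> adjoin \<iota> S \<Longrightarrow> ev p x \<in> adjoin \<iota> S"
  by (induction p) (auto simp: adjoin_closed adjoin_incl)

text \<open>The lists on which evaluation has to be injective are exactly the reversed coefficient
  lists of polynomials over the constant field.\<close>

lemma transcendental_iff:
  "ring.transcendental ring_of_type_algebra (range \<iota>) x \<longleftrightarrow> (\<forall>p. ev p x = 0 \<longrightarrow> p = 0)"
proof -
  let ?L = "{ps. ps = [] \<or> set ps \<subseteq> range \<iota> \<and> hd ps \<noteq> 0}" and ?e = "\<lambda>ps. poly (Poly (rev ps)) x"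
  have L_list: "\<exists>p. ps = rev (coeffs (map_poly \<iota> p))" if ps: "ps \<in> ?L" for ps
  proof -
    obtain qs where qs: "ps = map \<iota> qs"
    proof -
      have "\<forall>y\<in>set ps. \<exists>z. y = \<iota> z" using ps by auto
      then have "\<exists>qs. ps = map \<iota> qs"
        by (simp add: ex_map_conv)
      then show thesis using that by blast
    qed
    \<comment> \<open>The first entry of \<open>ps\<close> is non-zero, so no coefficient is
      stripped.\<close>
    have "coeffs (Poly (rev ps)) = rev ps"
      using ps by (cases ps) (auto simp: strip_while_def)
    moreover have "Poly (map \<iota> xs) = map_poly \<iota> (Poly xs)" for xs
      by (induction xs) (simp_all add: map_poly_hom_pCons)
    then have "Poly (rev ps) = map_poly \<iota> (Poly (rev qs))" by (simp only: qs rev_map)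
    ultimately have "ps = rev (coeffs (map_poly \<iota> (Poly (rev qs))))" by (metis rev_rev_ident)
    then show ?thesis ..
  qed
  have list_L: "rev (coeffs (map_poly \<iota> p)) \<in> ?L" for p
  proof (cases "p = 0")
    case False
    then have "map_poly \<iota> p \<noteq> 0" using map_poly_hom_eq_iff[of p 0] by simp
    moreover have "set (coeffs (map_poly \<iota> p)) \<subseteq> range \<iota>"
      by (auto simp: coeffs_def coeff_map_poly)
    ultimately show ?thesis
      by (auto simp: hd_rev last_coeffs_eq_coeff_degree)
  qed simp
  have eval: "?e (rev (coeffs (map_poly \<iota> p))) = ev p x" for p
    by (simp add: ev_def)
  show ?thesis
    unfolding rta_transcendental[OF refl]
  proof safe
    fix p assume inj: "inj_on ?e ?L" and "ev p x = 0"
    then have "?e (rev (coeffs (map_poly \<iota> p))) = ?e (rev (coeffs (map_poly \<iota> 0)))" by (simp only: eval) simp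
    from inj_onD[OF inj this list_L list_L] have "rev (coeffs (map_poly \<iota> p)) = rev (coeffs (map_poly \<iota> 0))" .
    then have "map_poly \<iota> p = 0" by simp
    then show "p = 0" using map_poly_hom_eq_iff[of p 0] by simp
  next
    assume *: "\<forall>p. ev p x = 0 \<longrightarrow> p = 0"
    show "inj_on ?e ?L"
    proof (rule inj_onI)
      fix ps qs assume ps: "ps \<in> ?L" and qs: "qs \<in> ?L" and e: "?e ps = ?e qs"
      obtain p where p: "ps = rev (coeffs (map_poly \<iota> p))" using L_list[OF ps] ..
      obtain q where q: "qs = rev (coeffs (map_poly \<iota> q))" using L_list[OF qs] ..
      have "ev p x = ev q x" using e unfolding p q eval .
      then have "p - q = 0" by (intro *[rule_format]) simp
      then show "ps = qs" by (simp add: p q)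
    qed
  qed
qed

lemma adjoin_single: "adjoin \<iota> {x} = {ev p x / ev q x | p q. True}" (is "_ = ?F")
proof
  have "subfield_set ?F"
    unfolding subfield_set_def
  proof (intro conjI ballI)
    show "1 \<in> ?F" by (force intro: exI[of _ 1])
    fix y assume "y \<in> ?F"
    then obtain p q where y: "y = ev p x / ev q x" by blast
    have "- y = ev (- 1 * p) x / ev q x" using ev_simps(5)[of 0 p x] y by simp
    then show "- y \<in> ?F" by blast
    show "inverse y \<in> ?F" using y by (auto simp: inverse_divide)
    fix z assume "z \<in> ?F"
    then obtain r s where z: "z = ev r x / ev s x" by blast
    have "y * z = ev (p * r) x / ev (q * s) x" by (simp add: y z)
    then show "y * z \<in> ?F" by blast
    \<comment> \<open>Division by zero gives 0, so with a vanishing denominator the sum is just the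
      other summand.\<close>
    consider "ev q x = 0" | "ev s x = 0" | "ev q x \<noteq> 0" "ev s x \<noteq> 0" by blast
    then show "y + z \<in> ?F"
    proof cases
      case 3
      then have "y + z = ev (p * s + r * q) x / ev (q * s) x" by (simp add: y z add_frac_eq)
      then show ?thesis by blast
    qed (use y z in auto)
  qed
  moreover have "range \<iota> \<subseteq> ?F"
  proof safe
    fix a show "\<exists>p q. \<iota> a = ev p x / ev q x \<and> True"
      by (intro exI[of _ "[:a:]"] exI[of _ 1]) simp
  qed
  moreover have "{x} \<subseteq> ?F"
    proof safe
    have "x = ev [:0, 1:] x / ev 1 x" by simp
    then show "\<exists>p q. x = ev p x / ev q x \<and> True"
      by blast
  qed
  ultimately show "adjoin \<iota> {x} \<subseteq> ?F" by (rule adjoin_least)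
  show "?F \<subseteq> adjoin \<iota> {x}" using ev_mem[OF adjoin_incl(2)[of x "{x}" \<iota>]] by (auto intro: adjoin_closed(8))
qed

text \<open>The elements a + by form a field: products use that y^2 lies in k(x), inverses use the
  conjugate a - by.\<close>

lemma adjoin_pair:
  assumes "y \<notin> adjoin \<iota> {x}" "y ^ 2 \<in> adjoin \<iota> {x}" "z \<in> adjoin \<iota> {x, y}"
  shows "\<exists>a\<in>adjoin \<iota> {x}. \<exists>b\<in>adjoin \<iota> {x}. z = a + b * y"
proof -
  let ?k = "adjoin \<iota> {x}"
  let ?F = "{a + b * y | a b. a \<in> ?k \<and> b \<in> ?k}"
  have F_I: "a + b * y \<in> ?F" if "a \<in> ?k" "b \<in> ?k" for a b using that by blast
  have "subfield_set ?F"
    unfolding subfield_set_def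
  proof (intro conjI ballI)
    show "1 \<in> ?F" using F_I[OF adjoin_closed(1,2)] by simp
    fix u assume "u \<in> ?F"
    then obtain a b where u: "u = a + b * y" and ab: "a \<in> ?k" "b \<in> ?k" by blast
    show "- u \<in> ?F" using F_I[of "- a" "- b"] ab by (simp add: u adjoin_closed)
    show "inverse u \<in> ?F"
    proof (cases "u = 0")
      case True
      then show ?thesis using F_I[of 0 0] by (simp add: adjoin_closed)
    next
      case False
      \<comment> \<open>The norm of \<open>u\<close>. If it vanished for non-zero \<open>u\<close>,
        then a = by, and \<open>y\<close> would lie in k(x).\<close>
      define d where "d = a ^ 2 - b ^ 2 * y ^ 2"
      have d: "d \<in> ?k" using ab assms by (simp add: d_def adjoin_closed)
      have dmul: "(a + b * y) * (a - b * y) = d" by (simp add: d_def algebra_simps power2_eq_square)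
      have "d \<noteq> 0"
      proof
        assume "d = 0"
        then have e: "a - b * y = 0" using dmul False u by simp
        have "b = 0"
        proof (rule ccontr)
          assume "b \<noteq> 0"
          then have "y = a / b" using e by (simp add: field_simps)
          then show False using ab assms(1) adjoin_closed(8) by metis
        qed
        then show False using e False u by simp
      qed
      then have "inverse u = a / d + (- b / d) * y"
        using dmul False u by (simp add: field_simps)
      then show ?thesis using F_I[of "a / d" "- b / d"] ab d by (simp add: adjoin_closed)
    qed
    fix v assume "v \<in> ?F"
    then obtain a' b' where v: "v = a' + b' * y" and ab': "a' \<in> ?k" "b' \<in> ?k" by blast
    have "u + v = (a + a') + (b + b') * y" by (simp add: u v algebra_simps)
    then show "u + v \<in> ?F" using F_I[of "a + a'" "b + b'"] ab ab' by (simp add: adjoin_closed)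
    have "u * v = (a * a' + b * b' * y ^ 2) + (a * b' + a' * b) * y"
      by (simp add: u v algebra_simps power2_eq_square)
    then show "u * v \<in> ?F"
      using F_I[of "a * a' + b * b' * y ^ 2" "a * b' + a' * b"] ab ab' assms by (simp add: adjoin_closed)
  qed
  moreover have "range \<iota> \<subseteq> ?F" using F_I[of "\<iota> _" 0] by (auto simp: adjoin_closed adjoin_incl)
  moreover have "{x, y} \<subseteq> ?F"
    using F_I[of x 0] F_I[of 0 1] by (auto simp: adjoin_closed adjoin_incl)
  ultimately have "adjoin \<iota> {x, y} \<subseteq> ?F" by (rule adjoin_least)
  then show ?thesis using assms(3) by blast
qed

text \<open>Evaluation of fractions at \<open>x\<close> is the isomorphism. It is independent of the
  representing fraction because non-zero denominators have non-zero values.\<close>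

lemma is_projective_line_adjoin:
  assumes "\<And>p. ev p x = 0 \<Longrightarrow> p = 0"
  shows "is_projective_line \<iota> (adjoin \<iota> {x})"
proof -
  define \<phi> :: "'k poly fract \<Rightarrow> 'K" where
    "\<phi> z = (THE w. \<exists>p q. q \<noteq> 0 \<and> z = Fraction_Field.Fract p q \<and> w = ev p x / ev q x)" for z
  have \<phi>: "\<phi> (Fraction_Field.Fract p q) = ev p x / ev q x" if q: "q \<noteq> 0" for p q
    unfolding \<phi>_def
  proof (rule the_equality)
    fix w assume "\<exists>p' q'. q' \<noteq> 0 \<and> Fraction_Field.Fract p q = Fraction_Field.Fract p' q' \<and> w = ev p' x / ev q' x"
    then obtain p' q' where *: "q' \<noteq> 0" "p * q' = p' * q" "w = ev p' x / ev q' x"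
      using q by (auto simp: eq_fract)
    from *(2) have "ev p x * ev q' x = ev p' x * ev q x" by (metis ev_simps(6))
    moreover have "ev q x \<noteq> 0" "ev q' x \<noteq> 0" using assms q * by auto
    ultimately show "w = ev p x / ev q x" unfolding *(3) by (simp add: frac_eq_eq)
  qed (use q in blast)
  have "field_embedding \<phi>"
    unfolding field_embedding_def ring_hom_def
  proof (safe; simp only: rta_simps[OF refl] iso_tuple_UNIV_I)
    fix y z :: "'k poly fract"
    obtain p q where y: "y = Fraction_Field.Fract p q" "q \<noteq> 0" by (cases y)
    obtain r s where z: "z = Fraction_Field.Fract r s" "s \<noteq> 0" by (cases z)
    have nz: "ev q x \<noteq> 0" "ev s x \<noteq> 0" using assms y z by auto
    show "\<phi> (y * z) = \<phi> y * \<phi> z" using y z by (simp add: \<phi>)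
    show "\<phi> (y + z) = \<phi> y + \<phi> z" using y z nz by (simp add: \<phi> add_frac_eq)
  next
    show "\<phi> 1 = 1" by (simp add: One_fract_def \<phi>)
  qed
  moreover have "range \<phi> = adjoin \<iota> {x}"
  proof
    show "range \<phi> \<subseteq> adjoin \<iota> {x}"
    proof safe
      fix z :: "'k poly fract"
      obtain p q where z: "z = Fraction_Field.Fract p q" "q \<noteq> 0" by (cases z)
      then show "\<phi> z \<in> adjoin \<iota> {x}" by (auto simp: \<phi> adjoin_single)
    qed
    show "adjoin \<iota> {x} \<subseteq> range \<phi>"
    proof
      fix z assume "z \<in> adjoin \<iota> {x}"
      then obtain p q where z: "z = ev p x / ev q x" by (auto simp: adjoin_single)
      show "z \<in> range \<phi>"
      proof (cases "q = 0")
        case True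
        then have "z = \<phi> (Fraction_Field.Fract 0 1)" using \<phi>[of 1 0] z by simp
        then show ?thesis by blast
      next
        case False
        then have "z = \<phi> (Fraction_Field.Fract p q)" using \<phi> z by simp
        then show ?thesis by blast
      qed
    qed
  qed
  moreover have "\<phi> (Fraction_Field.Fract [:a:] 1) = \<iota> a" for a by (simp add: \<phi>)
  ultimately show ?thesis unfolding is_projective_line_def by blast
qed

end

lemma field_emb_to_ac: "field_emb to_ac"
  by unfold_locales (simp add: field_embedding_def ring_hom_def rta_simps[OF refl])

interpretation ac: field_emb to_ac
  by (rule field_emb_to_ac)

section \<open>The action on the curve\<close>

text \<open>The hypotheses of the theorem with the equation of the curve unfolded; \<open>h0\<close>
  is c f as a polynomial over the constant field.\<close>

locale curve_action = field_emb \<iota> for \<iota> :: "'k::field \<Rightarrow> 'K::field" +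
  fixes Xc Yc :: 'K and c :: 'k and R :: "'k alg_closure set" and h0 :: "'k poly"
    and G :: "('K \<Rightarrow> 'K) set" and \<alpha> \<beta> \<gamma> :: "('K \<Rightarrow> 'K) \<Rightarrow> 'k"
  assumes char: "CHAR('k) \<noteq> 2"
    and finite_R: "finite R" and R_nonempty: "R \<noteq> {}" and c_nz: "c \<noteq> 0"
    and h0: "map_poly to_ac h0 = Polynomial.smult (to_ac c) (\<Prod>r\<in>R. [:- r, 1:])"
    and Y_sq: "Yc ^ 2 = ev h0 Xc"
    and transc: "\<And>p. ev p Xc = 0 \<Longrightarrow> p = 0"
    and Y_notin: "Yc \<notin> adjoin \<iota> {Xc}"
    and generated: "UNIV = adjoin \<iota> {Xc, Yc}"
    and finite_G: "finite G" and subgroup_G: "subgroup G (aut_group \<iota>)"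
    and G_X: "\<And>g. g \<in> G \<Longrightarrow> g Xc = \<iota> (\<alpha> g) * Xc + \<iota> (\<beta> g)"
    and G_Y: "\<And>g. g \<in> G \<Longrightarrow> g Yc = \<iota> (\<gamma> g) * Yc"
begin

lemma two: "(2::'k) \<noteq> 0"
proof
  assume "(2::'k) = 0"
  then have "of_nat 2 = (0::'k)" by simp
  then have "CHAR('k) dvd 2" by (simp only: of_nat_eq_0_iff_char_dvd)
  then have "CHAR('k) = 1" using char two_is_prime_nat by (metis prime_nat_iff)
  then show False by (simp add: CHAR_eqI)
qed

lemma two_ac: "(2::'k alg_closure) \<noteq> 0"
  using two by (metis to_ac_numeral to_ac_eq_0_iff)

lemma two_K: "(2::'K) \<noteq> 0"
  using two hom_add[of 1 1] by (metis hom_1 hom_eq_0_iff one_add_one)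

section \<open>Elements of \<open>G\<close> as field homomorphisms\<close>

lemma G_hom:
  assumes "g \<in> G"
  shows "g (x + y) = g x + g y" "g (x * y) = g x * g y" "g 1 = 1" "g (\<iota> a) = \<iota> a" "inj g"
proof -
  have "g \<in> carrier (aut_group \<iota>)" using assms subgroup.subset[OF subgroup_G] by blast
  then have "g \<in> ring_iso ring_of_type_algebra ring_of_type_algebra" "\<forall>a. g (\<iota> a) = \<iota> a"
    by (auto simp: aut_group_def)
  then show "g (x + y) = g x + g y" "g (x * y) = g x * g y" "g 1 = 1" "g (\<iota> a) = \<iota> a" "inj g"
    by (auto simp: ring_iso_def ring_hom_def rta_simps[OF refl] bij_betw_def)
qed

lemma G_0: "g \<in> G \<Longrightarrow> g 0 = 0"
  using G_hom(1)[of g 0 0] by (metis add_0 add_left_cancel add.right_neutral)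

lemma G_uminus: "g \<in> G \<Longrightarrow> g (- x) = - g x"
  using G_hom(1)[of g x "- x"] G_0[of g] by (simp add: eq_neg_iff_add_eq_0 add.commute[of "g x"])

lemma G_inverse: assumes "g \<in> G" shows "g (inverse x) = inverse (g x)"
proof (cases "x = 0")
  case False
  then have "g x * g (inverse x) = 1" using G_hom[OF assms] by (metis right_inverse)
  then show ?thesis by (metis inverse_unique)
qed (simp add: assms G_0)

lemma G_divide: "g \<in> G \<Longrightarrow> g (x / y) = g x / g y"
  by (simp add: divide_inverse G_hom G_inverse)

lemma G_ev: "g \<in> G \<Longrightarrow> g (ev p x) = ev p (g x)"
  by (induction p) (auto simp: G_hom G_0)

lemma id_G: "id \<in> G"
  using subgroup.one_closed[OF subgroup_G] by (simp add: aut_group_def)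

lemma comp_G: "g \<in> G \<Longrightarrow> h \<in> G \<Longrightarrow> g \<circ> h \<in> G"
  using subgroup.m_closed[OF subgroup_G, of g h] by (simp add: aut_group_def)

lemma inj_comp: "g \<in> G \<Longrightarrow> inj_on ((\<circ>) g) S"
  using G_hom(5)[of g] by (auto simp: inj_on_def fun_eq_iff)

lemma comp_image: "g \<in> G \<Longrightarrow> (\<circ>) g ` G = G"
  by (rule endo_inj_surj) (auto simp: finite_G comp_G inj_comp)

lemma comp_solve:
  assumes "g \<in> G" "h \<in> G" obtains k where "k \<in> G" "h = g \<circ> k"
  using comp_image[OF assms(1)] assms(2) by blast

text \<open>The functions on which \<open>g\<close> and \<open>h\<close> agree form a subfield
  containing the constants and both generators.\<close>

lemma G_eqI:
  assumes "g \<in> G" "h \<in> G" "g Xc = h Xc" "g Yc = h Yc" shows "g = h"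
proof -
  have "adjoin \<iota> {Xc, Yc} \<subseteq> {z. g z = h z}"
    by (rule adjoin_least) (use assms in \<open>auto simp: subfield_set_def G_hom G_uminus G_inverse\<close>)
  then show ?thesis using generated by auto
qed

lemma subfield_set_fixed_field: "subfield_set (fixed_field G)"
  by (auto simp: subfield_set_def fixed_field_def G_hom G_uminus G_inverse)

lemma const_fixed_field: "range \<iota> \<subseteq> fixed_field G"
  by (auto simp: fixed_field_def G_hom)

section \<open>The action on the X-line\<close>

definition prm :: "('K \<Rightarrow> 'K) \<Rightarrow> 'k \<times> 'k" where
  "prm g = (\<alpha> g, \<beta> g)"

lemma act_X: "g \<in> G \<Longrightarrow> g Xc = ev (aff_poly (prm g)) Xc"
  by (simp add: G_X aff_poly_def prm_def mult.commute add.commute)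

lemma ev_X_inj: "ev p Xc = ev q Xc \<Longrightarrow> p = q"
  using transc[of "p - q"] by simp

text \<open>Acting on functions by pull-back reverses the order of composition.\<close>
lemma prm_comp: assumes "g \<in> G" "h \<in> G" shows "prm (g \<circ> h) = aff_mult (prm h) (prm g)"
proof -
  have "ev (aff_poly (prm (g \<circ> h))) Xc = g (h Xc)"
    using act_X[OF comp_G[OF assms]] by simp
  also have "\<dots> = ev (aff_poly (aff_mult (prm h) (prm g))) Xc"
    using assms by (simp add: act_X G_ev flip: pcompose_aff_poly)
  finally show ?thesis using ev_X_inj inj_aff_poly by (metis injD)
qed

lemma prm_id: "prm id = (1, 0)"
proof -
  have "ev (aff_poly (prm id)) Xc = ev (aff_poly (1, 0)) Xc"
    using act_X[OF id_G] by (simp add: aff_poly_def)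
  then show ?thesis using ev_X_inj inj_aff_poly by (metis injD)
qed

lemma \<alpha>_comp: "g \<in> G \<Longrightarrow> h \<in> G \<Longrightarrow> \<alpha> (g \<circ> h) = \<alpha> g * \<alpha> h"
  using prm_comp[of g h] by (simp add: prm_def aff_mult_def)

lemma Y_nz: "Yc \<noteq> 0"
  using Y_notin adjoin_closed(2) by metis

lemma \<gamma>_comp: assumes "g \<in> G" "h \<in> G" shows "\<gamma> (g \<circ> h) = \<gamma> g * \<gamma> h"
proof -
  have "\<iota> (\<gamma> (g \<circ> h)) * Yc = g (h Yc)" using G_Y[OF comp_G[OF assms]] by simp
  also have "\<dots> = \<iota> (\<gamma> g * \<gamma> h) * Yc" using assms by (simp add: G_Y G_hom)
  finally show ?thesis using Y_nz by (simp del: hom_mult)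
qed

lemma \<gamma>_id: "\<gamma> id = 1"
  using G_Y[OF id_G] Y_nz by (metis hom_1 hom_eq_iff id_apply mult_cancel_right1)

lemma \<alpha>_nz: assumes "g \<in> G" shows "\<alpha> g \<noteq> 0"
proof -
  obtain k where "k \<in> G" "id = g \<circ> k" using comp_solve[OF assms id_G] .
  then show ?thesis using \<alpha>_comp[OF assms, of k] prm_id by (auto simp: prm_def)
qed

lemma \<gamma>_nz: assumes "g \<in> G" shows "\<gamma> g \<noteq> 0"
proof -
  obtain k where "k \<in> G" "id = g \<circ> k" using comp_solve[OF assms id_G] .
  then show ?thesis using \<gamma>_comp[OF assms, of k] \<gamma>_id by auto
qed

text \<open>The image of \<open>G\<close> among the affine maps; \<open>\<gamma>\<close> is
  forgotten, so the hyperelliptic involution becomes the identity.\<close>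

definition P :: "('k \<times> 'k) set" where
  "P = prm ` G"

text \<open>The same maps over the algebraic closure, where the roots \<open>R\<close> live.\<close>

definition P_ac :: "('k alg_closure \<times> 'k alg_closure) set" where
  "P_ac = map_prod to_ac to_ac ` P"

sublocale aff: affine_group P
proof
  show "(1, 0) \<in> P" unfolding P_def using prm_id id_G by (metis imageI)
  show "fst p \<noteq> 0" if "p \<in> P" for p using that \<alpha>_nz by (auto simp: P_def prm_def)
  show "aff_mult p q \<in> P" if "p \<in> P" "q \<in> P" for p q
    using that comp_G by (auto simp: P_def simp flip: prm_comp)
qed (simp add: P_def finite_G)

lemma inj_map_prod_to_ac: "inj_on (map_prod to_ac to_ac) S"
  by (auto simp: inj_on_def)

lemma aff_mult_to_ac: "aff_mult (map_prod to_ac to_ac p) (map_prod to_ac to_ac q) = map_prod to_ac to_ac (aff_mult p q)"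
  by (simp add: aff_mult_def)

lemma aff_act_to_ac: "aff_act (map_prod to_ac to_ac p) (to_ac x) = to_ac (aff_act p x)"
  by (simp add: aff_act_def)

lemma aff_poly_to_ac: "aff_poly (map_prod to_ac to_ac p) = map_poly to_ac (aff_poly p)"
  by (simp add: aff_poly_def ac.map_poly_hom_pCons)

sublocale aff_ac: affine_group P_ac
proof
  show "(1, 0) \<in> P_ac" unfolding P_ac_def by (rule image_eqI[OF _ aff.one_P]) simp
  show "fst p \<noteq> 0" if "p \<in> P_ac" for p using that aff.fst_nz by (auto simp: P_ac_def)
  show "aff_mult p q \<in> P_ac" if pq: "p \<in> P_ac" "q \<in> P_ac" for p q
  proof -
    obtain p' q' where "p' \<in> P" "q' \<in> P" "p = map_prod to_ac to_ac p'" "q = map_prod to_ac to_ac q'"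
      using pq unfolding P_ac_def by (elim imageE)
    then show ?thesis using aff.mult_P by (auto simp: P_ac_def aff_mult_to_ac simp del: map_prod_simp)
  qed
qed (simp add: P_ac_def aff.finite_P)

lemma fst_P_ac: "fst ` P_ac = to_ac ` (fst ` P)"
  by (force simp: P_ac_def)

lemma card_fst_P_ac: "card (fst ` P_ac) = card (fst ` P)"
  unfolding fst_P_ac by (rule card_image) (auto simp: inj_on_def)

lemma norm_poly_ac: "aff_ac.norm_poly = map_poly to_ac aff.norm_poly"
  unfolding aff_ac.norm_poly_def aff.norm_poly_def unfolding P_ac_def
  by (subst prod.reindex[OF inj_map_prod_to_ac]) (simp add: ac.map_poly_hom_prod aff_poly_to_ac o_def)

lemma B_ac: "aff_ac.B = to_ac ` aff.B"
  unfolding aff_ac.B_def aff.B_def unfolding P_ac_def by (force simp: image_iff)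

lemma trans_poly_ac: "aff_ac.trans_poly = map_poly to_ac aff.trans_poly"
proof -
  have "inj_on to_ac aff.B" by (auto simp: inj_on_def)
  then show ?thesis
    unfolding aff_ac.trans_poly_def aff.trans_poly_def B_ac
    by (simp add: prod.reindex ac.map_poly_hom_prod o_def ac.map_poly_hom_pCons)
qed

text \<open>A fixed point of x -> ax + b with a different from 1 is b / (1 - a), hence rational over
  the constant field.\<close>

lemma W_ac: "aff_ac.W = to_ac ` aff.W"
proof
  show "to_ac ` aff.W \<subseteq> aff_ac.W"
  proof safe
    fix x assume "x \<in> aff.W"
    then obtain p where p: "p \<in> P" "p \<noteq> (1, 0)" "aff_act p x = x" by (auto simp: aff.W_def)
    let ?p = "map_prod to_ac to_ac p"
    have "?p \<in> P_ac" "?p \<noteq> (1, 0)" "aff_act ?p (to_ac x) = to_ac x"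
      using p by (cases p; auto simp: P_ac_def aff_act_to_ac simp del: map_prod_simp; simp)+
    then show "to_ac x \<in> aff_ac.W" unfolding aff_ac.W_def by blast
  qed
  show "aff_ac.W \<subseteq> to_ac ` aff.W"
  proof
    fix x assume "x \<in> aff_ac.W"
    then obtain a b where p: "(a, b) \<in> P" "(to_ac a, to_ac b) \<noteq> (1, 0)" "aff_act (to_ac a, to_ac b) x = x"
      unfolding aff_ac.W_def unfolding P_ac_def by force
    have a: "a \<noteq> 1" using aff_ac.fixed_fst_neq_1[OF p(2,3)] by auto
    then have "to_ac (1 - a) \<noteq> 0" by (simp only: ac.hom_eq_0_iff) simp
    moreover have "to_ac (1 - a) * x = to_ac b" using p(3) by (simp add: aff_act_def algebra_simps)
    ultimately have "x = to_ac (b / (1 - a))" by (simp add: field_simps)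
    moreover have "b / (1 - a) \<in> aff.W" using aff.W_I(1)[OF p(1)] a by simp
    ultimately show "x \<in> to_ac ` aff.W" by blast
  qed
qed

lemma root_orbits_eq: "root_orbits \<alpha> \<beta> G R = aff_ac.orb ` R"
  unfolding root_orbits_def aff_ac.orb_def
  unfolding P_ac_def P_def prm_def aff_act_def image_image by simp

section \<open>The action on the equation\<close>

text \<open>Apply \<open>g\<close> to the equation Y^2 = h0(X); X being transcendental, the result
  is an identity of polynomials.\<close>

lemma h0_pcompose:
  assumes "g \<in> G" shows "pcompose h0 (aff_poly (prm g)) = Polynomial.smult ((\<gamma> g)\<^sup>2) h0"
proof (rule ev_X_inj)
  have "ev (pcompose h0 (aff_poly (prm g))) Xc = g (ev h0 Xc)"
    using assms by (simp add: G_ev act_X)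
  also have "\<dots> = (g Yc)\<^sup>2" using assms by (simp add: Y_sq[symmetric] power2_eq_square G_hom)
  also have "\<dots> = ev (Polynomial.smult ((\<gamma> g)\<^sup>2) h0) Xc"
    using assms by (simp add: G_Y power_mult_distrib Y_sq)
  finally show "ev (pcompose h0 (aff_poly (prm g))) Xc = ev (Polynomial.smult ((\<gamma> g)\<^sup>2) h0) Xc" .
qed

lemma h0_root_iff: "poly (map_poly to_ac h0) x = 0 \<longleftrightarrow> x \<in> R"
  using c_nz finite_R by (auto simp: h0 poly_prod)

lemma h0_nz: "h0 \<noteq> 0"
proof
  assume "h0 = 0"
  then have "Polynomial.smult (to_ac c) (\<Prod>r\<in>R. [:- r, 1:]) = 0" using h0 by simp
  then show False using c_nz finite_R by auto
qed

lemma degree_h0: "degree h0 = card R"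
proof -
  have "degree h0 = degree (map_poly to_ac h0)" by (simp add: ac.degree_map_poly_hom)
  also have "\<dots> = degree (\<Prod>r\<in>R. [:- r, 1:])" using c_nz by (simp add: h0)
  also have "\<dots> = card R" by (subst degree_prod_eq_sum_degree) auto
  finally show ?thesis .
qed

lemma R_stable:
  assumes "p \<in> P_ac" "r \<in> R" shows "aff_act p r \<in> R"
proof -
  obtain g where g: "g \<in> G" "p = map_prod to_ac to_ac (prm g)" using assms(1) unfolding P_ac_def P_def by (elim imageE) simp
  have "poly (map_poly to_ac h0) (aff_act p r) = poly (map_poly to_ac (pcompose h0 (aff_poly (prm g)))) r"
    by (simp add: ac.map_poly_hom_pcompose poly_pcompose g flip: aff_poly_to_ac)
  also have "\<dots> = 0"
    using assms(2) by (simp add: h0_pcompose[OF g(1)] ac.map_poly_hom_smult h0_root_iff)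
  finally show ?thesis by (simp add: h0_root_iff)
qed

text \<open>Comparison of leading coefficients in \<open>h0_pcompose\<close>.\<close>

lemma \<gamma>_sq: assumes "g \<in> G" shows "(\<gamma> g)\<^sup>2 = \<alpha> g ^ card R"
proof -
  have d: "degree (aff_poly (prm g)) = 1" "lead_coeff (aff_poly (prm g)) = \<alpha> g"
    using \<alpha>_nz[OF assms] by (auto simp: aff_poly_def prm_def)
  have "(\<gamma> g)\<^sup>2 * lead_coeff h0 = lead_coeff (pcompose h0 (aff_poly (prm g)))"
    by (simp add: h0_pcompose[OF assms])
  also have "\<dots> = lead_coeff h0 * \<alpha> g ^ card R"
    using d by (simp add: lead_coeff_comp degree_h0)
  finally show ?thesis using h0_nz by simp
qed

lemma \<alpha>_power_card_R:
  assumes "g \<in> G" shows "\<alpha> g ^ card R = (if aff_ac.W \<subseteq> R then \<alpha> g else 1)"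
proof -
  have "map_prod to_ac to_ac (prm g) \<in> P_ac" using assms by (auto simp: P_ac_def P_def)
  from aff_ac.fst_power_card_stable[OF finite_R R_stable this]
  have "to_ac (\<alpha> g ^ card R) = to_ac (if aff_ac.W \<subseteq> R then \<alpha> g else 1)"
    by (simp add: prm_def)
  then show ?thesis by (simp only: to_ac_eq_iff)
qed

section \<open>Invariant rational functions\<close>

text \<open>The norm of X under \<open>P\<close>: equal to \<open>I\<close> if \<open>prm\<close> is
  injective on \<open>G\<close>, and a square root of \<open>I\<close> if \<open>G\<close> contains
  the hyperelliptic involution.\<close>

definition J :: 'K where
  "J = ev aff.norm_poly Xc"

lemma J_fixed: "J \<in> fixed_field G"
  using aff.invariant_norm_poly
  by (auto simp: fixed_field_def J_def G_ev act_X P_def simp flip: ev_pcompose)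

lemma J_transc: "ev p J = 0 \<Longrightarrow> p = 0"
proof -
  assume "ev p J = 0"
  then have "pcompose p aff.norm_poly = 0" by (intro transc) (simp add: J_def)
  then show ?thesis
    using aff.degree_norm_poly aff.card_P_pos pcompose_eq_0 by metis
qed

text \<open>Once the denominator is replaced by its norm \<open>Q\<close>, the numerator is
  invariant as well, and both are polynomials in \<open>norm_poly\<close>.\<close>

lemma fixed_rational:
  assumes "z \<in> adjoin \<iota> {Xc}" "\<And>g. g \<in> G \<Longrightarrow> g z = z"
  shows "z \<in> adjoin \<iota> {J}"
proof -
  obtain p q where z: "z = ev p Xc / ev q Xc" using assms(1) by (auto simp: adjoin_single)
  show ?thesis
  proof (cases "q = 0")
    case True
    then show ?thesis using z by (simp add: adjoin_closed)
  next
    case False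
    define Q where "Q = (\<Prod>a\<in>P. pcompose q (aff_poly a))"
    \<comment> \<open>The product runs over the conjugates of \<open>q\<close> other than
      \<open>q\<close> itself, so that s / Q = p / q.\<close>
    define s where "s = p * (\<Prod>a\<in>P - {(1, 0)}. pcompose q (aff_poly a))"
    have Q: "pcompose Q (aff_poly b) = Q" if "b \<in> P" for b
      unfolding Q_def using aff.prod_right[OF that, of "\<lambda>a. pcompose q (aff_poly a)", symmetric]
      by (simp add: pcompose_prod pcompose_aff_poly flip: pcompose_assoc)
    have "Q \<noteq> 0"
    proof -
      have "pcompose q (aff_poly a) \<noteq> 0" if "a \<in> P" for a
        using False aff.fst_nz[OF that] pcompose_eq_0[of q "aff_poly a"] by (auto simp: aff_poly_def)
      then show ?thesis using aff.finite_P by (simp add: Q_def)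
    qed
    then have Q0: "ev Q Xc \<noteq> 0" using transc by blast
    have "Q = q * (\<Prod>a\<in>P - {(1, 0)}. pcompose q (aff_poly a))"
      unfolding Q_def using aff.finite_P aff.one_P by (subst prod.remove[of P "(1, 0)"]) (auto simp: aff_poly_def)
    then have "ev Q Xc = ev q Xc * ev (\<Prod>a\<in>P - {(1, 0)}. pcompose q (aff_poly a)) Xc" by simp
    then have zs: "z = ev s Xc / ev Q Xc" using Q0 z by (simp add: s_def)
    have s: "pcompose s (aff_poly b) = s" if b: "b \<in> P" for b
    proof (rule ev_X_inj)
      obtain g where g: "g \<in> G" "b = prm g" using b by (auto simp: P_def)
      have "ev s Xc = z * ev Q Xc" using zs Q0 by simp
      also have "\<dots> = g z * ev (pcompose Q (aff_poly b)) Xc" using assms(2)[OF g(1)] Q[OF b] by simp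
      also have "\<dots> = g (z * ev Q Xc)" using g by (simp add: G_hom G_ev act_X)
      also have "\<dots> = g (ev s Xc)" using zs Q0 by simp
      also have "\<dots> = ev (pcompose s (aff_poly b)) Xc" using g by (simp add: G_ev act_X)
      finally show "ev (pcompose s (aff_poly b)) Xc = ev s Xc" ..
    qed
    obtain s' Q' where "s = pcompose s' aff.norm_poly" "Q = pcompose Q' aff.norm_poly"
      using aff.invariant_imp_pcompose_norm s Q by metis
    then have "z = ev s' J / ev Q' J" using zs by (simp add: J_def)
    then show ?thesis by (auto simp: adjoin_single)
  qed
qed

section \<open>Functions a + bY and the equation of the quotient\<close>

lemma Y_sq_mem: "Yc\<^sup>2 \<in> adjoin \<iota> {Xc}"
  by (simp add: Y_sq ev_mem adjoin_incl)

lemma decompose: obtains a b where "a \<in> adjoin \<iota> {Xc}" "b \<in> adjoin \<iota> {Xc}" "z = a + b * Yc"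
  using adjoin_pair[OF Y_notin Y_sq_mem, of z] generated by blast

lemma decompose_unique:
  assumes "a + b * Yc = a' + b' * Yc" "a \<in> adjoin \<iota> {Xc}" "b \<in> adjoin \<iota> {Xc}"
    "a' \<in> adjoin \<iota> {Xc}" "b' \<in> adjoin \<iota> {Xc}"
  shows "a = a' \<and> b = b'"
proof -
  have e: "(b - b') * Yc = a' - a" using assms(1) by (simp add: algebra_simps)
  have "b = b'"
  proof (rule ccontr)
    assume "b \<noteq> b'"
    then have "Yc = (a' - a) / (b - b')" using e by (simp add: field_simps)
    then show False using Y_notin assms adjoin_closed(7,8) by metis
  qed
  then show ?thesis using e by simp
qed

lemma G_adjoin: "g \<in> G \<Longrightarrow> z \<in> adjoin \<iota> {Xc} \<Longrightarrow> g z \<in> adjoin \<iota> {Xc}"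
proof -
  assume g: "g \<in> G" and "z \<in> adjoin \<iota> {Xc}"
  then obtain p q where "z = ev p Xc / ev q Xc" by (auto simp: adjoin_single)
  moreover have "g Xc \<in> adjoin \<iota> {Xc}" using act_X[OF g] ev_mem[OF adjoin_incl(2)[of Xc "{Xc}" \<iota>]] by simp
  ultimately show "g z \<in> adjoin \<iota> {Xc}"
    by (simp add: g G_divide G_ev ev_mem adjoin_closed(8))
qed

text \<open>The criterion for the two cases without involution: an invariant multiple wY with w in
  k(X) generates the fixed field over k(J), and its square, a pull-back of \<open>H\<close> along
  the norm, gives the equation.\<close>

lemma quotient_equation:
  assumes H: "map_poly to_ac q = pcompose H (map_poly to_ac aff.norm_poly)"
    and w: "w \<in> adjoin \<iota> {Xc}" "w \<noteq> 0" and y_sq: "(w * Yc)\<^sup>2 = ev q Xc"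
    and y_fixed: "\<And>g. g \<in> G \<Longrightarrow> g (w * Yc) = w * Yc"
  shows "function_field_of_equation \<iota> (fixed_field G) H J (w * Yc)"
proof -
  let ?y = "w * Yc"
  have y_notin: "?y \<notin> adjoin \<iota> {Xc}"
  proof
    assume "?y \<in> adjoin \<iota> {Xc}"
    then have "?y / w \<in> adjoin \<iota> {Xc}" using w by (simp only: adjoin_closed)
    then show False using Y_notin w by simp
  qed
  have J_mem: "J \<in> adjoin \<iota> {Xc}" by (simp add: J_def ev_mem adjoin_incl)
  have J_sub: "adjoin \<iota> {J} \<subseteq> adjoin \<iota> {Xc}"
    by (intro adjoin_least subfield_set_adjoin) (auto simp: adjoin_incl J_mem)
  have "fixed_field G = adjoin \<iota> {J, ?y}"
  proof
    show "adjoin \<iota> {J, ?y} \<subseteq> fixed_field G"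
      using J_fixed y_fixed
      by (intro adjoin_least subfield_set_fixed_field const_fixed_field) (auto simp: fixed_field_def)
    show "fixed_field G \<subseteq> adjoin \<iota> {J, ?y}"
    proof
      fix z assume z: "z \<in> fixed_field G"
      obtain a b where ab: "a \<in> adjoin \<iota> {Xc}" "b \<in> adjoin \<iota> {Xc}" "z = a + b * Yc"
        using decompose .
      \<comment> \<open>With respect to 1 and wY the coefficients of an invariant function are
        themselves invariant, so \<open>fixed_rational\<close> applies to them.\<close>
      define b' where "b' = b / w"
      have b': "b' \<in> adjoin \<iota> {Xc}" "z = a + b' * ?y" using ab w by (auto simp: b'_def adjoin_closed)
      have "g a = a \<and> g b' = b'" if g: "g \<in> G" for g
      proof -
        have "g a + (g b' * w) * Yc = a + (b' * w) * Yc"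
        proof -
          have "z = g a + g b' * g ?y" using z b'(2) g by (metis (mono_tags, lifting) G_hom(1,2) fixed_field_def mem_Collect_eq)
          then show ?thesis using b'(2) y_fixed[OF g] by (simp add: mult.assoc)
        qed
        then have "g a = a \<and> g b' * w = b' * w"
          using ab b' w g by (intro decompose_unique) (simp_all add: adjoin_closed G_adjoin)
        then show ?thesis using w by simp
      qed
      then have "a \<in> adjoin \<iota> {J}" "b' \<in> adjoin \<iota> {J}" using fixed_rational ab b' by blast+
      moreover have "adjoin \<iota> {J} \<subseteq> adjoin \<iota> {J, ?y}"
        by (intro adjoin_least subfield_set_adjoin) (auto simp: adjoin_incl)
      moreover have "?y \<in> adjoin \<iota> {J, ?y}" by (simp add: adjoin_incl)
      ultimately show "z \<in> adjoin \<iota> {J, ?y}"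
        unfolding b'(2) by (meson adjoin_closed(5,6) subsetD)
    qed
  qed
  moreover have "ring.transcendental ring_of_type_algebra (range \<iota>) J"
    using J_transc by (simp add: transcendental_iff)
  moreover have "?y \<notin> adjoin \<iota> {J}" using y_notin J_sub by blast
  moreover have "\<exists>h. map_poly to_ac h = H \<and> ?y\<^sup>2 = poly (map_poly \<iota> h) J"
  proof -
    \<comment> \<open>\<open>H\<close> is given over the algebraic closure; descent provides its
      model over the constant field.\<close>
    obtain h where "map_poly to_ac h = H" "q = pcompose h aff.norm_poly"
      using ac.pcompose_descend[OF _ H[symmetric]] aff.degree_norm_poly aff.card_P_pos by auto
    then show ?thesis using y_sq by (auto simp: J_def simp flip: ev_def)
  qed
  ultimately show ?thesis unfolding function_field_of_equation_def by blast
qed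

section \<open>The hyperelliptic involution\<close>

lemma prm_eq_iff:
  assumes "g \<in> G" "h \<in> G"
  shows "prm g = prm h \<longleftrightarrow> g Xc = h Xc"
  using act_X[OF assms(1)] act_X[OF assms(2)] ev_X_inj inj_aff_poly by (metis injD)

text \<open>By \<open>\<gamma>_sq\<close> the action on X determines \<open>\<gamma>\<close> up to
  sign.\<close>

lemma prm_eq_imp:
  assumes "g \<in> G" "h \<in> G" "prm g = prm h"
  shows "g Yc = h Yc \<or> g Yc = - h Yc"
proof -
  have "(\<gamma> g)\<^sup>2 = (\<gamma> h)\<^sup>2" using assms by (simp add: \<gamma>_sq prm_def)
  then show ?thesis using assms by (auto simp: G_Y power2_eq_iff)
qed

text \<open>If \<open>g\<close> and \<open>h\<close> act alike on X, their quotient \<open>k\<close>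
  fixes X and sends Y to Y or -Y; the second is excluded.\<close>

lemma inj_prm_if:
  assumes "\<not> (\<exists>\<sigma>\<in>G. \<sigma> Xc = Xc \<and> \<sigma> Yc = - Yc)"
  shows "inj_on prm G"
proof (rule inj_onI)
  fix g h assume gh: "g \<in> G" "h \<in> G" "prm g = prm h"
  obtain k where k: "k \<in> G" "h = g \<circ> k" using comp_solve[OF gh(1,2)] .
  have "g Xc = h Xc" using prm_eq_iff gh by blast
  then have kX: "k Xc = Xc" using injD[OF G_hom(5)[OF gh(1)], of "k Xc" Xc] k by simp
  then have "prm k = prm id" using prm_eq_iff[OF k(1) id_G] by simp
  then have "k Yc = Yc" using prm_eq_imp[OF k(1) id_G] assms k(1) kX by auto
  then show "g = h" using gh k \<open>g Xc = h Xc\<close> by (intro G_eqI) auto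
qed

lemma inj_prm_norm:
  assumes "inj_on prm G" shows "(\<Prod>g\<in>G. g Xc) = J" "card G = card P"
proof -
  show "(\<Prod>g\<in>G. g Xc) = J"
    unfolding J_def aff.norm_poly_def unfolding P_def
    by (simp add: prod.reindex[OF assms] ev_prod act_X)
  show "card G = card P" by (simp add: P_def card_image[OF assms])
qed

text \<open>The fibres of \<open>prm\<close> are the pairs \<open>g\<close>,
  \<open>g \<circ> \<sigma>\<close>, so every factor of the norm occurs twice.\<close>

lemma prod_fix_involution:
  assumes \<sigma>: "\<sigma> \<in> G" "\<sigma> Xc = Xc" "\<sigma> Yc = - Yc"
  shows "(\<Prod>g\<in>G. g Xc) = J\<^sup>2"
proof -
  have "(\<Prod>g\<in>G. g Xc) = (\<Prod>g\<in>G. ev (aff_poly (prm g)) Xc)"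
    by (intro prod.cong refl act_X)
  also have "\<dots> = (\<Prod>p\<in>prm ` G. ev (aff_poly p) Xc)\<^sup>2"
  proof (rule prod_const_fibres[OF finite_G])
    fix p assume "p \<in> prm ` G"
    then obtain g where g: "g \<in> G" "p = prm g" by blast
    have g\<sigma>: "g \<circ> \<sigma> \<in> G" "(g \<circ> \<sigma>) Xc = g Xc" "(g \<circ> \<sigma>) Yc = - g Yc"
      using comp_G[OF g(1) \<sigma>(1)] \<sigma> by (simp_all add: G_uminus[OF g(1)])
    have "g Yc \<noteq> 0" using injD[OF G_hom(5)[OF g(1)], of Yc 0] Y_nz by (auto simp: G_0[OF g(1)])
    then have "g \<noteq> g \<circ> \<sigma>" using g\<sigma>(3) two_K by (metis eq_neg_iff_add_eq_0 mult_2 mult_eq_0_iff)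
    moreover have "{h \<in> G. prm h = p} = {g, g \<circ> \<sigma>}"
    proof
      show "{h \<in> G. prm h = p} \<subseteq> {g, g \<circ> \<sigma>}"
      proof
        fix h assume "h \<in> {h \<in> G. prm h = p}"
        then have h: "h \<in> G" "prm h = prm g" using g by auto
        then have "h Xc = g Xc" using prm_eq_iff g by blast
        moreover have "h Yc = g Yc \<or> h Yc = - g Yc" using prm_eq_imp h g by blast
        ultimately show "h \<in> {g, g \<circ> \<sigma>}" using G_eqI[OF h(1)] g(1) g\<sigma> by auto
      qed
      show "{g, g \<circ> \<sigma>} \<subseteq> {h \<in> G. prm h = p}"
        using g g\<sigma> prm_eq_iff[OF g\<sigma>(1) g(1)] by simp
    qed
    ultimately show "card {h \<in> G. prm h = p} = 2" by simp
  qed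
  also have "(\<Prod>p\<in>prm ` G. ev (aff_poly p) Xc) = J"
    by (simp add: J_def aff.norm_poly_def ev_prod P_def[symmetric])
  finally show ?thesis .
qed

text \<open>\<open>\<sigma>\<close> fixes k(X) and negates Y, so an invariant a + bY has b =
  0.\<close>

lemma fixed_field_involution:
  assumes \<sigma>: "\<sigma> \<in> G" "\<sigma> Xc = Xc" "\<sigma> Yc = - Yc"
  shows "fixed_field G = adjoin \<iota> {J}"
proof
  show "adjoin \<iota> {J} \<subseteq> fixed_field G"
    by (intro adjoin_least subfield_set_fixed_field const_fixed_field) (simp add: J_fixed)
  show "fixed_field G \<subseteq> adjoin \<iota> {J}"
  proof
    fix z assume z: "z \<in> fixed_field G"
    obtain a b where ab: "a \<in> adjoin \<iota> {Xc}" "b \<in> adjoin \<iota> {Xc}" "z = a + b * Yc"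
      using decompose .
    have \<sigma>_id: "\<sigma> u = u" if "u \<in> adjoin \<iota> {Xc}" for u
      using that \<sigma> by (auto simp: adjoin_single G_divide G_ev)
    have "\<sigma> z = z" using z \<sigma>(1) by (auto simp: fixed_field_def)
    then have "a + (- b) * Yc = a + b * Yc"
      using ab \<sigma> \<sigma>_id by (simp add: G_hom)
    then have "- b = b" using ab by (blast dest: decompose_unique intro: adjoin_closed)
    then have "b = 0" using two_K by (metis add.left_inverse mult_2 mult_eq_0_iff)
    then show "z \<in> adjoin \<iota> {J}" using ab z by (intro fixed_rational) (auto simp: fixed_field_def)
  qed
qed

lemma quotient_involution:
  assumes \<sigma>: "\<sigma> \<in> G" "\<sigma> Xc = Xc" "\<sigma> Yc = - Yc" and I: "I = (\<Prod>g\<in>G. g Xc)"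
  shows "is_projective_line \<iota> (fixed_field G)" "\<exists>S\<in>adjoin \<iota> {Xc}. S\<^sup>2 = I"
    "\<forall>S\<in>adjoin \<iota> {Xc}. S\<^sup>2 = I \<longrightarrow> fixed_field G = adjoin \<iota> {S}"
proof -
  note I = I[unfolded prod_fix_involution[OF \<sigma>]] and F = fixed_field_involution[OF \<sigma>]
  show "is_projective_line \<iota> (fixed_field G)"
    unfolding F by (rule is_projective_line_adjoin) (rule J_transc)
  show "\<exists>S\<in>adjoin \<iota> {Xc}. S\<^sup>2 = I"
    using I by (intro bexI[of _ J]) (simp_all add: J_def ev_mem adjoin_incl)
  show "\<forall>S\<in>adjoin \<iota> {Xc}. S\<^sup>2 = I \<longrightarrow> fixed_field G = adjoin \<iota> {S}"
  proof (intro ballI impI)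
    fix S assume "S\<^sup>2 = I"
    then have S: "S = J \<or> S = - J" by (simp add: I power2_eq_iff)
    have "adjoin \<iota> {- u} \<subseteq> adjoin \<iota> {u}" for u
      by (intro adjoin_least subfield_set_adjoin) (auto simp: adjoin_incl adjoin_closed)
    from this[of J] this[of "- J"] show "fixed_field G = adjoin \<iota> {S}" using S F by auto
  qed
qed

section \<open>Trivial action on Y\<close>

lemma W_ac_nonempty_iff: "aff_ac.W \<noteq> {} \<longleftrightarrow> (\<exists>g\<in>G. \<alpha> g \<noteq> 1)"
proof
  assume "aff_ac.W \<noteq> {}"
  then obtain x where "x \<in> aff.W" using W_ac by auto
  then obtain p where p: "p \<in> P" "p \<noteq> (1, 0)" "aff_act p x = x" by (auto simp: aff.W_def)
  then have "fst p \<noteq> 1" using aff.fixed_fst_neq_1 by blast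
  then show "\<exists>g\<in>G. \<alpha> g \<noteq> 1" using p(1) by (auto simp: P_def prm_def)
next
  assume "\<exists>g\<in>G. \<alpha> g \<noteq> 1"
  then obtain g where g: "g \<in> G" "\<alpha> g \<noteq> 1" by blast
  then have "prm g \<in> P" "fst (prm g) \<noteq> 1" by (auto simp: P_def prm_def)
  then show "aff_ac.W \<noteq> {}" using aff.W_I(1) W_ac by blast
qed

text \<open>Trivial \<open>\<gamma>\<close> keeps the points with non-trivial stabilizer away from
  the roots, so \<open>roots_poly_regular\<close> and \<open>quotient_equation\<close> with w = 1
  apply.\<close>

lemma quotient_trivial_on_Y:
  assumes triv: "\<forall>g\<in>G. g Yc = Yc" and RG: "RG = root_orbits \<alpha> \<beta> G R"
  shows "function_field_of_equation \<iota> (fixed_field G)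
    (Polynomial.smult (to_ac c * (- 1) ^ (card R - card RG)) (\<Prod>Q\<in>RG. [:- (\<Prod>r\<in>Q. r), 1:]))
    (\<Prod>g\<in>G. g Xc) Yc"
proof -
  have "Yc \<noteq> - Yc" using Y_nz two_K by (metis eq_neg_iff_add_eq_0 mult_2 mult_eq_0_iff)
  then have inj: "inj_on prm G" using triv by (intro inj_prm_if) metis
  have \<gamma>: "\<gamma> g = 1" if "g \<in> G" for g
    using G_Y[OF that] triv that Y_nz by (metis hom_1 hom_eq_iff mult_cancel_right1)
  have disj: "aff_ac.W \<inter> R = {}"
  proof (rule ccontr)
    assume "aff_ac.W \<inter> R \<noteq> {}"
    then have "aff_ac.W \<subseteq> R" "aff_ac.W \<noteq> {}" using aff_ac.W_subset_or_disjoint[OF R_stable] by blast+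
    \<comment> \<open>Otherwise \<open>\<alpha> g\<close> = \<open>\<alpha> g ^ card R\<close> =
      \<open>(\<gamma> g)\<^sup>2\<close> = 1 for all \<open>g\<close>, and there would be no fixed
      points.\<close>
    then show False
      using W_ac_nonempty_iff \<alpha>_power_card_R \<gamma>_sq \<gamma> by (metis power_one)
  qed
  define E where "E = (\<Prod>Q\<in>RG. [:- (\<Prod>r\<in>Q. r), 1:])"
  have "map_poly to_ac h0 = pcompose (Polynomial.smult (to_ac c * (- 1) ^ (card R - card RG)) E)
      (map_poly to_ac aff.norm_poly)"
    using aff_ac.roots_poly_regular[OF two_ac finite_R R_stable disj]
    by (simp add: h0 pcompose_smult norm_poly_ac RG root_orbits_eq E_def)
  from quotient_equation[OF this, of 1] show ?thesis
    using triv by (simp add: adjoin_closed inj_prm_norm(1)[OF inj] Y_sq E_def)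
qed

section \<open>The character \<open>\<gamma>\<close> and the twisted case\<close>

text \<open>As in Lagrange's theorem, composition with \<open>g\<close> permutes \<open>S\<close>;
  applied to \<open>G\<close> and to its translation subgroup.\<close>

lemma \<gamma>_power_card:
  assumes "finite S" "S \<subseteq> G" "g \<in> S" "\<And>h. h \<in> S \<Longrightarrow> g \<circ> h \<in> S"
  shows "\<gamma> g ^ card S = 1"
proof -
  have g: "g \<in> G" using assms by blast
  have "(\<circ>) g ` S = S"
    by (rule endo_inj_surj) (use assms inj_comp[OF g] in auto)
  then have "(\<Prod>h\<in>S. \<gamma> h) = (\<Prod>h\<in>S. \<gamma> (g \<circ> h))"
    using prod.reindex[OF inj_comp[OF g], of \<gamma> S] by (simp add: o_def)
  also have "\<dots> = (\<Prod>h\<in>S. \<gamma> g * \<gamma> h)"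
    using assms(2) g by (intro prod.cong refl \<gamma>_comp) auto
  also have "\<dots> = \<gamma> g ^ card S * (\<Prod>h\<in>S. \<gamma> h)" by (simp add: prod.distrib)
  finally show ?thesis using assms \<gamma>_nz by (auto simp: subset_iff)
qed

lemma bij_translations:
  assumes "inj_on prm G"
  shows "bij_betw \<beta> {g \<in> G. \<alpha> g = 1} aff.B"
proof (rule bij_betw_imageI)
  show "inj_on \<beta> {g \<in> G. \<alpha> g = 1}"
    using assms by (auto simp: inj_on_def prm_def)
  show "\<beta> ` {g \<in> G. \<alpha> g = 1} = aff.B"
  proof -
    have "b \<in> aff.B \<longleftrightarrow> (\<exists>g\<in>G. \<alpha> g = 1 \<and> \<beta> g = b)" for b
      unfolding aff.B_def unfolding P_def prm_def by auto
    then show ?thesis by auto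
  qed
qed

text \<open>The value is a sign, and the translation subgroup has odd order.\<close>

lemma \<gamma>_translation:
  assumes inj: "inj_on prm G" and g: "g \<in> G" "\<alpha> g = 1" shows "\<gamma> g = 1"
proof -
  have "\<gamma> g ^ card {g \<in> G. \<alpha> g = 1} = 1"
    by (rule \<gamma>_power_card) (use g finite_G in \<open>auto simp: comp_G \<alpha>_comp\<close>)
  moreover have "odd (card {g \<in> G. \<alpha> g = 1})"
    using bij_betw_same_card[OF bij_translations[OF inj]] aff.odd_card_B[OF two] by simp
  moreover have "\<gamma> g = 1 \<or> \<gamma> g = - 1"
    using \<gamma>_sq[OF g(1)] g(2) by (simp add: power2_eq_1_iff)
  ultimately show ?thesis by auto
qed

text \<open>The quotient of \<open>g\<close> and \<open>h\<close> is a translation, so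
  \<open>\<gamma>\<close> factors through \<open>\<alpha>\<close>.\<close>

lemma \<gamma>_eq_if_\<alpha>_eq:
  assumes "inj_on prm G" "g \<in> G" "h \<in> G" "\<alpha> g = \<alpha> h" shows "\<gamma> g = \<gamma> h"
proof -
  obtain k where k: "k \<in> G" "h = g \<circ> k" using comp_solve[OF assms(2,3)] .
  then have "\<alpha> k = 1" using \<alpha>_comp[OF assms(2) k(1)] assms(4) \<alpha>_nz[OF assms(2)] by simp
  then show ?thesis using \<gamma>_translation[OF assms(1) k(1)] \<gamma>_comp[OF assms(2) k(1)] k(2) by simp
qed

lemma \<alpha>_image: "fst ` P = \<alpha> ` G"
  by (simp add: P_def prm_def image_image)

lemma twisted_parity:
  assumes inj: "inj_on prm G" and nontriv: "\<exists>g\<in>G. \<gamma> g \<noteq> 1"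
  shows "aff_ac.W \<inter> R = {} \<Longrightarrow> even (card (\<alpha> ` G))"
    and "aff_ac.W \<subseteq> R \<Longrightarrow> odd (card (\<alpha> ` G))"
proof -
  have card_G: "card G = card (\<alpha> ` G) * card aff.B"
    using inj_prm_norm(2)[OF inj] aff.card_P_eq \<alpha>_image by simp
  have W: "aff_ac.W \<noteq> {}" using nontriv \<gamma>_translation[OF inj] W_ac_nonempty_iff by blast
  show "even (card (\<alpha> ` G))" if "aff_ac.W \<inter> R = {}"
  proof -
    have "\<not> aff_ac.W \<subseteq> R" using that W by blast
    then have *: "(\<gamma> g)\<^sup>2 = 1" if "g \<in> G" for g using that by (simp add: \<gamma>_sq \<alpha>_power_card_R)
    obtain g where g: "g \<in> G" "\<gamma> g \<noteq> 1" using nontriv by blast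
    then have "\<gamma> g = - 1" using *[OF g(1)] by (simp add: power2_eq_1_iff)
    moreover have "\<gamma> g ^ card G = 1" by (rule \<gamma>_power_card) (use g finite_G comp_G in auto)
    \<comment> \<open>A value -1 of \<open>\<gamma>\<close> forces even order, and
      \<open>card aff.B\<close> is odd.\<close>
    ultimately have "even (card G)" using two by (metis minus_one_power_iff g(2))
    then show ?thesis using aff.odd_card_B[OF two] by (simp add: card_G)
  qed
  show "odd (card (\<alpha> ` G))" if "aff_ac.W \<subseteq> R"
  proof
    assume "even (card (\<alpha> ` G))"
    then have "- 1 \<in> fst ` P" using aff.units.minus_one_mem \<alpha>_image by simp
    then obtain g where g: "g \<in> G" "\<alpha> g = - 1" using \<alpha>_image by (metis imageE)
    \<comment> \<open>Here \<open>\<gamma>\<close> squares to \<open>\<alpha>\<close>; but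
      \<open>g \<circ> g\<close> has linear part 1, so it is a translation and
      \<open>\<gamma>\<close> is 1 on it.\<close>
    have "(\<gamma> g)\<^sup>2 = - 1" using \<gamma>_sq[OF g(1)] \<alpha>_power_card_R[OF g(1)] that g(2) by simp
    moreover have "\<gamma> (g \<circ> g) = 1"
      by (rule \<gamma>_translation[OF inj]) (use g in \<open>auto simp: comp_G \<alpha>_comp\<close>)
    ultimately have "(- 1 :: 'k) = 1" using \<gamma>_comp[OF g(1) g(1)] by (simp add: power2_eq_square)
    then show False using two by (metis add.left_inverse one_add_one)
  qed
qed

text \<open>This makes the new y-coordinate invariant: \<open>g\<close> multiplies
  \<open>I\<^sub>T - \<iota> l\<close> by \<open>\<alpha> g\<close> and Y by
  \<open>\<gamma> g\<close>.\<close>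

lemma twisted_character:
  assumes inj: "inj_on prm G" and nontriv: "\<exists>g\<in>G. \<gamma> g \<noteq> 1" and n: "n = card (\<alpha> ` G)" and g: "g \<in> G"
  shows "\<alpha> g ^ (n div 2) * \<gamma> g = 1"
proof -
  note parity = twisted_parity[OF inj nontriv, folded n]
  have card_G: "card G = n * card aff.B"
    using inj_prm_norm(2)[OF inj] aff.card_P_eq \<alpha>_image n by simp
  have \<alpha>n: "\<alpha> h ^ n = 1" if "h \<in> G" for h
    using aff.units.power_card[of "\<alpha> h"] that n \<alpha>_image by auto
  show ?thesis
  proof (cases "aff_ac.W \<subseteq> R")
    case True
    then have "odd n" by (rule parity)
    then obtain k where k: "n = 2 * k + 1" by (elim oddE)
    have "(\<gamma> g)\<^sup>2 = \<alpha> g" using True g by (simp add: \<gamma>_sq \<alpha>_power_card_R)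
    \<comment> \<open>The expression is \<open>\<gamma> g ^ n\<close>. Its square is
      \<open>\<alpha> g ^ n\<close> = 1, so it is a sign; its power with the odd exponent
      \<open>card aff.B\<close> is \<open>\<gamma> g ^ card G\<close> = 1.\<close>
    then have e: "\<alpha> g ^ (n div 2) * \<gamma> g = \<gamma> g ^ n" by (simp add: k power_mult)
    have "(\<gamma> g ^ n)\<^sup>2 = 1"
      using \<alpha>n[OF g] \<open>(\<gamma> g)\<^sup>2 = \<alpha> g\<close> by (metis power_mult mult.commute)
    then have "\<gamma> g ^ n = 1 \<or> \<gamma> g ^ n = - 1" by (simp add: power2_eq_1_iff)
    moreover have "(\<gamma> g ^ n) ^ card aff.B = 1"
      using \<gamma>_power_card[OF finite_G _ g] comp_G[OF g] by (simp add: card_G power_mult)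
    ultimately show ?thesis using e aff.odd_card_B[OF two] by auto
  next
    case False
    then have "aff_ac.W \<inter> R = {}" using aff_ac.W_subset_or_disjoint[OF R_stable] by blast
    then have "even n" by (rule parity)
    then obtain k where k: "n = 2 * k" by (elim evenE)
    have \<gamma>pm: "\<gamma> h = 1 \<or> \<gamma> h = - 1" if "h \<in> G" for h
      using \<gamma>_sq[OF that] \<alpha>_power_card_R[OF that] False by (simp add: power2_eq_1_iff)
    obtain g1 where g1: "g1 \<in> G" "\<gamma> g1 = - 1" using nontriv \<gamma>pm by blast
    have neg: "(- 1 :: 'k) \<noteq> 1" using two by (metis add.left_inverse one_add_one)
    \<comment> \<open>\<open>M\<close> and \<open>M'\<close> are the two cosets of the index 2 subgroup \<open>M\<close> of the image of \<open>\<alpha>\<close>, and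
      \<open>M\<close> is the set of all roots of \<open>x\<^sup>k = 1\<close>.\<close>
    define M where "M = \<alpha> ` {h \<in> G. \<gamma> h = 1}"
    define M' where "M' = \<alpha> ` {h \<in> G. \<gamma> h = - 1}"
    have "M' = (*) (\<alpha> g1) ` M"
    proof
      show "(*) (\<alpha> g1) ` M \<subseteq> M'"
      proof
        fix x assume "x \<in> (*) (\<alpha> g1) ` M"
        then obtain h where h: "h \<in> G" "\<gamma> h = 1" "x = \<alpha> g1 * \<alpha> h" by (auto simp: M_def)
        then have "x = \<alpha> (g1 \<circ> h)" "\<gamma> (g1 \<circ> h) = - 1" "g1 \<circ> h \<in> G"
          using g1 by (simp_all add: \<alpha>_comp \<gamma>_comp comp_G)
        then show "x \<in> M'" by (auto simp: M'_def)
      qed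
      show "M' \<subseteq> (*) (\<alpha> g1) ` M"
      proof
        fix x assume "x \<in> M'"
        then obtain h where h: "h \<in> G" "\<gamma> h = - 1" "x = \<alpha> h" by (auto simp: M'_def)
        obtain j where j: "j \<in> G" "h = g1 \<circ> j" using comp_solve[OF g1(1) h(1)] .
        then have "\<gamma> j = 1" using \<gamma>_comp[OF g1(1) j(1)] h g1 by simp
        then show "x \<in> (*) (\<alpha> g1) ` M" using h j g1 by (auto simp: M_def \<alpha>_comp)
      qed
    qed
    then have card_M': "card M' = card M"
      using \<alpha>_nz[OF g1(1)] by (simp add: card_image inj_on_def)
    have "\<alpha> ` G = M \<union> M'" using \<gamma>pm by (auto simp: M_def M'_def)
    moreover have "M \<inter> M' = {}"
    proof (rule ccontr)
      assume "M \<inter> M' \<noteq> {}"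
      then obtain h h' where "h \<in> G" "h' \<in> G" "\<gamma> h = 1" "\<gamma> h' = - 1" "\<alpha> h = \<alpha> h'"
        by (auto simp: M_def M'_def)
      then show False using \<gamma>_eq_if_\<alpha>_eq[OF inj, of h h'] neg by simp
    qed
    moreover have fin: "finite M" "finite M'" using finite_G by (auto simp: M_def M'_def)
    ultimately have "n = card M + card M'" unfolding n by (simp add: card_Un_disjoint)
    then have card_M: "card M = k" using card_M' k by simp
    interpret M: finite_units M
    proof
      show "1 \<in> M" using id_G prm_id \<gamma>_id by (force simp: M_def prm_def)
      show "0 \<notin> M" using \<alpha>_nz by (auto simp: M_def)
      show "x * y \<in> M" if xy: "x \<in> M" "y \<in> M" for x y
      proof -
        obtain h j where "h \<in> G" "j \<in> G" "\<gamma> h = 1" "\<gamma> j = 1" "x = \<alpha> h" "y = \<alpha> j"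
          using xy by (auto simp: M_def)
        then show ?thesis unfolding M_def
          by (intro image_eqI[of _ _ "h \<circ> j"]) (simp_all add: \<alpha>_comp \<gamma>_comp comp_G)
      qed
    qed (rule fin)
    have k_pos: "k > 0" using card_M M.one_M fin by (auto simp: card_gt_0_iff)
    show ?thesis
    proof (cases "\<gamma> g = 1")
      case True
      then have "\<alpha> g ^ k = 1" using M.power_card[of "\<alpha> g"] g card_M by (simp add: M_def)
      then show ?thesis using True k by simp
    next
      case False
      then have \<gamma>: "\<gamma> g = - 1" using \<gamma>pm[OF g] by blast
      have "\<alpha> g ^ k \<noteq> 1"
      proof
        assume "\<alpha> g ^ k = 1"
        then have "card (insert (\<alpha> g) M) \<le> k"
          using k_pos g M.power_card card_M \<alpha>_image
          by (intro aff.units.card_roots_power_le) (auto simp: M_def)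
        moreover have "\<alpha> g \<notin> M" using \<open>M \<inter> M' = {}\<close> g \<gamma> by (auto simp: M'_def)
        ultimately show False using card_M fin by simp
      qed
      moreover have "(\<alpha> g ^ k)\<^sup>2 = 1" using \<alpha>n[OF g] k by (simp add: mult.commute flip: power_mult)
      ultimately have "\<alpha> g ^ k = - 1" by (simp add: power2_eq_1_iff)
      then show ?thesis using \<gamma> k by simp
    qed
  qed
qed

text \<open>\<open>g\<close> permutes the roots \<open>W\<close> of \<open>t\<close>; each linear
  factor contributes \<open>\<alpha> g\<close>, and \<open>\<alpha> g ^ card W\<close> =
  \<open>\<alpha> g\<close>.\<close>

lemma trans_poly_shift:
  assumes "g \<in> G" "aff.W \<noteq> {}"
  defines "t \<equiv> aff.trans_poly - [:\<Prod>aff.W:]"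
  shows "pcompose t (aff_poly (prm g)) = Polynomial.smult (\<alpha> g) t"
proof -
  have p: "prm g \<in> P" using assms by (simp add: P_def)
  have t: "t = (\<Prod>w\<in>aff.W. [:- w, 1:])" unfolding t_def by (rule aff.trans_poly_minus) fact
  have inj: "inj_on (aff_act (prm g)) aff.W"
    using \<alpha>_nz[OF assms(1)] by (auto simp: inj_on_def aff_act_def prm_def)
  have "aff_act (prm g) ` aff.W = aff.W"
    by (rule endo_inj_surj[OF aff.finite_W _ inj]) (use aff.W_orbit(1) p in \<open>auto simp: aff.orb_def\<close>)
  then have "t = (\<Prod>w\<in>aff.W. [:- aff_act (prm g) w, 1:])"
    unfolding t using prod.reindex[OF inj, of "\<lambda>w. [:- w, 1:]"] by simp
  then have "pcompose t (aff_poly (prm g)) = (\<Prod>w\<in>aff.W. pcompose [:- aff_act (prm g) w, 1:] (aff_poly (prm g)))"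
    by (simp only: pcompose_prod)
  also have "\<dots> = (\<Prod>w\<in>aff.W. [:\<alpha> g:] * [:- w, 1:])"
    by (intro prod.cong refl) (simp add: pcompose_pCons aff_poly_def prm_def aff_act_def)
  also have "\<dots> = [:\<alpha> g:] ^ card aff.W * t" by (simp only: t prod.distrib prod_constant)
  also have "\<dots> = Polynomial.smult (\<alpha> g) t"
    using aff.fst_power_card_W[OF p assms(2)] by (simp add: poly_const_pow prm_def)
  finally show ?thesis .
qed

text \<open>The criterion \<open>quotient_equation\<close> with w = t(X)^(m div 2), where
  \<open>t\<close> is the monic polynomial with simple roots \<open>U\<close>.\<close>

lemma quotient_twisted:
  assumes noninv: "\<not> (\<exists>\<sigma>\<in>G. \<sigma> Xc = Xc \<and> \<sigma> Yc = - Yc)" and nontriv: "\<not> (\<forall>g\<in>G. g Yc = Yc)"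
    and RG: "RG = root_orbits \<alpha> \<beta> G R"
    and U: "U = {a. \<exists>g\<in>G. g \<noteq> id \<and> \<alpha> g * a + \<beta> g = a}"
    and m: "m = card G div card U" and l: "l = (\<Prod>a\<in>U. a)"
    and \<delta>: "\<delta> = (m - 1) * (card RG - 1)"
    and I_T: "I\<^sub>T = (\<Prod>g\<in>{g \<in> G. \<alpha> g = 1}. g Xc)"
  shows "card U dvd card G"
    and "function_field_of_equation \<iota> (fixed_field G)
      (Polynomial.smult (to_ac c * (- 1) ^ \<delta>)
        ([:- to_ac (l ^ m), 1:] * (\<Prod>Q\<in>RG - {to_ac ` U}. [:- (\<Prod>r\<in>Q. r), 1:])))
      (\<Prod>g\<in>G. g Xc) ((I\<^sub>T - \<iota> l) ^ (m div 2) * Yc)"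
proof -
  have inj: "inj_on prm G" by (rule inj_prm_if) fact
  have nontriv: "\<exists>g\<in>G. \<gamma> g \<noteq> 1" using nontriv G_Y by (metis hom_1 mult_1)
  have W: "aff.W \<noteq> {}" using nontriv \<gamma>_translation[OF inj] W_ac_nonempty_iff W_ac by blast
  have prm_1: "prm g = (1, 0) \<longleftrightarrow> g = id" if "g \<in> G" for g
    using inj that id_G prm_id by (metis inj_onD)
  \<comment> \<open>As \<open>prm\<close> is injective, the non-trivial elements of \<open>G\<close>
    correspond to the affine maps other than the identity.\<close>
  have UW: "U = aff.W"
    unfolding U aff.W_def unfolding P_def using prm_1 by (auto simp: aff_act_def prm_def)
  have card_G: "card G = card (\<alpha> ` G) * card U"
    using inj_prm_norm(2)[OF inj] aff.card_P_eq aff.card_W[OF W] by (simp add: \<alpha>_image UW)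
  then show "card U dvd card G" by simp
  have "card U \<noteq> 0" using W aff.finite_W by (simp add: UW)
  \<comment> \<open>The division defining \<open>m\<close> is exact, and \<open>m\<close> is the
    number of linear parts.\<close>
  then have mn: "m = card (\<alpha> ` G)" using card_G m by simp
  define t where "t = aff.trans_poly - [:l:]"
  have I_T: "I\<^sub>T = ev aff.trans_poly Xc"
  proof -
    have "I\<^sub>T = (\<Prod>g\<in>{g \<in> G. \<alpha> g = 1}. ev [:\<beta> g, 1:] Xc)"
      unfolding I_T by (intro prod.cong refl) (auto simp: G_X add.commute)
    also have "\<dots> = (\<Prod>b\<in>aff.B. ev [:b, 1:] Xc)"
      by (rule prod.reindex_bij_betw[OF bij_translations[OF inj]])
    finally show ?thesis by (simp add: aff.trans_poly_def ev_prod)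
  qed
  have t: "I\<^sub>T - \<iota> l = ev t Xc" by (simp add: I_T t_def)
  have t_nz: "t \<noteq> 0"
    using aff.trans_poly_minus[OF W] aff.finite_W by (auto simp: t_def l UW)
  define E where "E = [:- to_ac (l ^ m), 1:] * (\<Prod>Q\<in>RG - {to_ac ` U}. [:- (\<Prod>r\<in>Q. r), 1:])"
  have l_ac: "to_ac l = \<Prod>aff_ac.W"
  proof -
    have "inj_on to_ac aff.W" by (auto simp: inj_on_def)
    then show ?thesis unfolding W_ac by (simp add: prod.reindex l UW ac.hom_prod)
  qed
  have W_ac_ne: "aff_ac.W \<noteq> {}" using W W_ac by simp
  have parity: "aff_ac.W \<inter> R = {} \<Longrightarrow> even m" "aff_ac.W \<subseteq> R \<Longrightarrow> odd m"
    using twisted_parity[OF inj nontriv] mn by simp_all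
  have m_ac: "m = card (fst ` P_ac)" by (simp add: mn card_fst_P_ac \<alpha>_image)
  \<comment> \<open>This polynomial in X is the square of wY.\<close>
  have "map_poly to_ac (t ^ (2 * (m div 2)) * h0)
    = Polynomial.smult (to_ac c) ((aff_ac.trans_poly - [:\<Prod>aff_ac.W:]) ^ (2 * (m div 2)) * (\<Prod>r\<in>R. [:- r, 1:]))"
    by (simp add: t_def ac.map_poly_hom_mult ac.map_poly_hom_power ac.map_poly_hom_diff
        ac.map_poly_hom_pCons h0 trans_poly_ac l_ac)
  also have "(aff_ac.trans_poly - [:\<Prod>aff_ac.W:]) ^ (2 * (m div 2)) * (\<Prod>r\<in>R. [:- r, 1:])
      = Polynomial.smult ((- 1) ^ \<delta>) (pcompose E aff_ac.norm_poly)"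
    using aff_ac.roots_poly_twisted[OF two_ac finite_R R_stable R_nonempty W_ac_ne m_ac parity]
    by (simp only: E_def \<delta> RG root_orbits_eq UW W_ac[symmetric] to_ac_power l_ac)
  finally have H: "map_poly to_ac (t ^ (2 * (m div 2)) * h0)
    = pcompose (Polynomial.smult (to_ac c * (- 1) ^ \<delta>) E) (map_poly to_ac aff.norm_poly)"
    by (simp add: pcompose_smult norm_poly_ac)
  have "function_field_of_equation \<iota> (fixed_field G) (Polynomial.smult (to_ac c * (- 1) ^ \<delta>) E) J
    (ev t Xc ^ (m div 2) * Yc)"
  proof (rule quotient_equation[OF H])
    show "ev t Xc ^ (m div 2) \<in> adjoin \<iota> {Xc}"
      by (intro adjoin_closed ev_mem adjoin_incl) simp
    show "ev t Xc ^ (m div 2) \<noteq> 0" using t_nz transc by auto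
    show "(ev t Xc ^ (m div 2) * Yc)\<^sup>2 = ev (t ^ (2 * (m div 2)) * h0) Xc"
      by (simp add: power_mult_distrib Y_sq mult.commute flip: power_mult)
    fix g assume g: "g \<in> G"
    have "g (ev t Xc) = \<iota> (\<alpha> g) * ev t Xc"
    proof -
      have "pcompose t (aff_poly (prm g)) = Polynomial.smult (\<alpha> g) t"
        unfolding t_def l UW by (rule trans_poly_shift[OF g W])
      then show ?thesis by (metis G_ev[OF g] act_X[OF g] ev_pcompose ev_simps(8))
    qed
    moreover have "g (x ^ k) = g x ^ k" for x and k :: nat
      by (induction k) (simp_all add: G_hom[OF g])
    ultimately have "g (ev t Xc ^ (m div 2) * Yc) = \<iota> (\<alpha> g ^ (m div 2) * \<gamma> g) * (ev t Xc ^ (m div 2) * Yc)"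
      by (simp add: G_hom[OF g] G_Y[OF g] power_mult_distrib)
    then show "g (ev t Xc ^ (m div 2) * Yc) = ev t Xc ^ (m div 2) * Yc"
      using twisted_character[OF inj nontriv mn g] by (simp del: hom_mult)
  qed
  then show "function_field_of_equation \<iota> (fixed_field G)
      (Polynomial.smult (to_ac c * (- 1) ^ \<delta>)
        ([:- to_ac (l ^ m), 1:] * (\<Prod>Q\<in>RG - {to_ac ` U}. [:- (\<Prod>r\<in>Q. r), 1:])))
      (\<Prod>g\<in>G. g Xc) ((I\<^sub>T - \<iota> l) ^ (m div 2) * Yc)"
    unfolding E_def t inj_prm_norm(1)[OF inj] .
qed

end

section \<open>The three cases brought together\<close>

theorem theorem2p4:
  fixes \<iota> :: "'k::field \<Rightarrow> 'K::field"
    and X\<^sub>C Y\<^sub>C :: 'K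
    and c :: 'k and R :: "'k alg_closure set" and f :: "'k alg_closure poly"
    and G :: "('K \<Rightarrow> 'K) set" and \<alpha> \<beta> \<gamma> :: "('K \<Rightarrow> 'K) \<Rightarrow> 'k"
    and I I\<^sub>T :: 'K and U :: "'k set" and l :: 'k and m \<delta> :: nat
    and RG :: "'k alg_closure set set"
  assumes char: "CHAR('k) \<noteq> 2"
    and const: "field_embedding \<iota>"
    and R: "finite R" "R \<noteq> {}"
    and c: "c \<noteq> 0"
    and f: "f = (\<Prod>r\<in>R. [:- r, 1:])"
    and C: "function_field_of_equation \<iota> UNIV (Polynomial.smult (to_ac c) f) X\<^sub>C Y\<^sub>C"
    and G: "finite G" "subgroup G (aut_group \<iota>)"
    and G_X: "\<And>g. g \<in> G \<Longrightarrow> g X\<^sub>C = \<iota> (\<alpha> g) * X\<^sub>C + \<iota> (\<beta> g)"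
    and G_Y: "\<And>g. g \<in> G \<Longrightarrow> g Y\<^sub>C = \<iota> (\<gamma> g) * Y\<^sub>C"
    and I: "I = (\<Prod>g\<in>G. g X\<^sub>C)"
    and RG: "RG = root_orbits \<alpha> \<beta> G R"
    and U: "U = {a. \<exists>g\<in>G. g \<noteq> id \<and> \<alpha> g * a + \<beta> g = a}"
    and m: "m = card G div card U"
    and lambda: "l = (\<Prod>a\<in>U. a)"
    and delta: "\<delta> = (m - 1) * (card RG - 1)"
    and I_T: "I\<^sub>T = (\<Prod>g\<in>{g \<in> G. \<alpha> g = 1}. g X\<^sub>C)"
  shows "((\<exists>\<sigma>\<in>G. \<sigma> X\<^sub>C = X\<^sub>C \<and> \<sigma> Y\<^sub>C = - Y\<^sub>C) \<longrightarrow>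
           is_projective_line \<iota> (fixed_field G) \<and>
           (\<exists>S\<in>adjoin \<iota> {X\<^sub>C}. S ^ 2 = I) \<and>
           (\<forall>S\<in>adjoin \<iota> {X\<^sub>C}. S ^ 2 = I \<longrightarrow> fixed_field G = adjoin \<iota> {S})) \<and>
         ((\<forall>g\<in>G. g Y\<^sub>C = Y\<^sub>C) \<longrightarrow>
           function_field_of_equation \<iota> (fixed_field G)
             (Polynomial.smult (to_ac c * (- 1) ^ (card R - card RG)) (\<Prod>Q\<in>RG. [:- (\<Prod>r\<in>Q. r), 1:]))
             I Y\<^sub>C) \<and>
         (\<not> (\<exists>\<sigma>\<in>G. \<sigma> X\<^sub>C = X\<^sub>C \<and> \<sigma> Y\<^sub>C = - Y\<^sub>C) \<and> \<not> (\<forall>g\<in>G. g Y\<^sub>C = Y\<^sub>C) \<longrightarrow>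
           card U dvd card G \<and>
           function_field_of_equation \<iota> (fixed_field G)
             (Polynomial.smult (to_ac c * (- 1) ^ \<delta>)
               ([:- to_ac (l ^ m), 1:] * (\<Prod>Q\<in>RG - {to_ac ` U}. [:- (\<Prod>r\<in>Q. r), 1:])))
             I ((I\<^sub>T - \<iota> l) ^ (m div 2) * Y\<^sub>C))"
proof -
  interpret field_emb \<iota> by unfold_locales (rule const)
  \<comment> \<open>The equation of the curve supplies c f as a polynomial over the constant field,
    the \<open>h0\<close> of the locale.\<close>
  obtain h where h: "map_poly to_ac h = Polynomial.smult (to_ac c) f" "Y\<^sub>C\<^sup>2 = ev h X\<^sub>C"
    using C unfolding function_field_of_equation_def ev_def by blast
  have "UNIV = adjoin \<iota> {X\<^sub>C, Y\<^sub>C}" "Y\<^sub>C \<notin> adjoin \<iota> {X\<^sub>C}"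
    "\<And>p. ev p X\<^sub>C = 0 \<Longrightarrow> p = 0"
    using C by (simp_all add: function_field_of_equation_def transcendental_iff)
  then interpret curve_action \<iota> X\<^sub>C Y\<^sub>C c R h G \<alpha> \<beta> \<gamma>
    using char R c h G G_X G_Y unfolding f
    by (intro curve_action.intro curve_action_axioms.intro field_emb_axioms)
  show ?thesis
    using quotient_involution[OF _ _ _ I] quotient_trivial_on_Y[OF _ RG]
      quotient_twisted[OF _ _ RG U m lambda delta I_T]
    unfolding I by blast
qed

end
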